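(* Consider a single-input/single-output system $\dot x=f(x,u)$, $y=h(x)$ with $x\in\mathbb{R}^n$, $u\in\mathbb{R}$, $y\in\mathbb{R}$ and $f,h$ smooth ($C^\infty$). 1. Suppose that the system has a relative degree $r$ and is weakly uniformly 0-detectable of order $k$, for some $k$. Then the system is output-input stable with $N=\max\{r,k\}$. 2. Suppose that the system is output-input stable with integer $N$. Then it is weakly uniformly 0-detectable of order $N$. 3. Suppose that the system is output-input stable with integer $N$, that the function $f(x,\cdot)$ is real analytic in $u$ for each fixed $x$, and that $f(0,0)=0$ and $h(0)=0$. Then the system has a relative degree $r\le N$.
   Context: Admissible inputs are locally essentially bounded Lebesgue measurable functions $u:[0,\infty)\to\mathbb{R}$; for each initial state $x(0)$ and input, $x(\cdot)$ is the maximally defined solution. $|\cdot|$ is the Euclidean norm and $\|z\|_{[a,b]}$ is the essential supremum of $|z(s)|$ over $s\in[a,b]$. A function $\alpha:[0,\infty)\to[0,\infty)$ is of class $\mathcal{K}$ if it is continuous, strictly increasing and $\alpha(0)=0$; of class $\mathcal{K}_\infty$ if also unbounded. A function $\beta:[0,\infty)\times[0,\infty)\to[0,\infty)$ is of class $\mathcal{KL}$ if $\beta(\cdot,t)$ is of class $\mathcal{K}$ for each fixed $t\ge 0$ and $\beta(s,t)$ decreases to $0$ as $t\to\infty$ for each fixed $s\ge 0$. For a scalar signal $y$, $\mathbf{y}^k:=(y;\dot y;\dots;y^{(k)})$. Functions $H_k:\mathbb{R}^n\times\mathbb{R}^k\to\mathbb{R}$ are defined by $H_0:=h$ and $$H_{k+1}(x,u_0,\dots,u_k):=\frac{\partial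 H_k}{\partial x}f(x,u_0)+\sum_{j=0}^{k-1}\frac{\partial H_k}{\partial u_j}u_{j+1},$$ where the arguments of $H_k$ are $(x,u_0,\dots,u_{k-1})$. If $u\in C^{k-1}$, then $y^{(k)}(t)=H_k(x(t),u(t),\dots,u^{(k-1)}(t))$. Output-input stability with integer $N$ ($N$ a positive integer): there exist $\beta\in\mathcal{KL}$ and $\gamma\in\mathcal{K}_\infty$ such that for every initial state $x(0)$ and every $N-1$ times continuously differentiable input $u$, $$\left|\begin{pmatrix}u(t)\\ x(t)\end{pmatrix}\right|\le\beta(|x(0)|,t)+\gamma(\|\mathbf{y}^N\|_{[0,t]})$$ for all $t$ in the domain of the corresponding solution. The system is output-input stable if this holds for some $N$. Relative degree: a positive integer $r$ is the (uniform) relative degree if (i) for each $k<r$ the function $H_k$ is independent of $u_0,\dots,u_{k-1}$ (so that $H_r$ depends only on $(x,u_0)$); and (ii) there exist $\rho_1,\rho_2\in\mathcal{K}_\infty$ with $|u_0|\le\rho_1(|x|)+\rho_2(|H_r(x,u_0)|)$ for all $x\in\mathbb{R}^n$, $u_0\in\mathbb{R}$. Weak uniform 0-detectability of order $k$ ($k$ a nonnegative integer): there exist $\beta\in\mathcal{KL}$ and $\gamma\in\mathcal{K}_\infty$ such that for every initial state $x(0)$ and every input $u\in C^{k-1}$ (every admissible input if $k=0$), $|x(t)|\le\beta(|x(0)|,t)+\gamma(\|\mathbf{y}^k\|_{[0,t]})$ as long as the solution exists. *)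

theory Defs
  imports "HOL-Probability.Essential_Supremum"
begin

text \<open>Functions on \<open>[0,\<infinity>)\<close> are total functions on the reals of which only the
  values on \<open>{0..}\<close> matter; nonnegativity on \<open>{0..}\<close> follows from
  \<open>\<alpha> 0 = 0\<close> and monotonicity.\<close>

definition class_K :: "(real \<Rightarrow> real) \<Rightarrow> bool" where
  "class_K \<alpha> \<longleftrightarrow> continuous_on {0..} \<alpha> \<and> strict_mono_on {0..} \<alpha> \<and> \<alpha> 0 = 0"

definition class_K_inf :: "(real \<Rightarrow> real) \<Rightarrow> bool" where
  "class_K_inf \<alpha> \<longleftrightarrow> class_K \<alpha> \<and> \<not> bdd_above (\<alpha> ` {0..})"

text \<open>``Decreases to 0'' is non-strict: \<open>\<beta> 0 t = 0\<close> for all \<open>t \<ge> 0\<close>.\<close>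

definition class_KL :: "(real \<Rightarrow> real \<Rightarrow> real) \<Rightarrow> bool" where
  "class_KL \<beta> \<longleftrightarrow>
     (\<forall>t\<ge>0. class_K (\<lambda>s. \<beta> s t)) \<and>
     (\<forall>s\<ge>0. antimono_on {0..} (\<beta> s) \<and> (\<beta> s \<longlongrightarrow> 0) at_top)"

primrec C_k :: "nat \<Rightarrow> ('a::real_normed_vector \<Rightarrow> 'b::real_normed_vector) \<Rightarrow> bool" where
  "C_k 0 g \<longleftrightarrow> continuous_on UNIV g"
| "C_k (Suc k) g \<longleftrightarrow>
     (\<forall>x. g differentiable (at x)) \<and> (\<forall>v. C_k k (\<lambda>x. frechet_derivative g (at x) v))"

definition C_infinity :: "('a::real_normed_vector \<Rightarrow> 'b::real_normed_vector) \<Rightarrow> bool" where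
  "C_infinity g \<longleftrightarrow> (\<forall>k. C_k k g)"

definition real_analytic :: "(real \<Rightarrow> 'a::real_normed_vector) \<Rightarrow> bool" where
  "real_analytic g \<longleftrightarrow>
     (\<forall>a. \<exists>c. \<exists>\<delta>>0. \<forall>s. \<bar>s - a\<bar> < \<delta> \<longrightarrow> (\<lambda>m. (s - a) ^ m *\<^sub>R c m) sums g s)"

text \<open>The \<open>j\<close>-th derivative of a signal defined on an interval \<open>I\<close>; it is one-sided at an
  end point belonging to \<open>I\<close>.\<close>

definition sig_deriv :: "real set \<Rightarrow> nat \<Rightarrow> (real \<Rightarrow> real) \<Rightarrow> real \<Rightarrow> real" where
  "sig_deriv I j y = ((\<lambda>g t. vector_derivative g (at t within I)) ^^ j) y"

definition C_sig :: "real set \<Rightarrow> nat \<Rightarrow> (real \<Rightarrow> real) \<Rightarrow> bool" where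
  "C_sig I m u \<longleftrightarrow>
     (\<forall>j<m. \<forall>t\<in>I. sig_deriv I j u differentiable (at t within I)) \<and>
     continuous_on I (sig_deriv I m u)"

definition admissible_input :: "(real \<Rightarrow> real) \<Rightarrow> bool" where
  "admissible_input u \<longleftrightarrow>
     u \<in> borel_measurable (lebesgue_on {0..}) \<and>
     (\<forall>b\<ge>0. \<exists>M. AE t in lebesgue_on {0..b}. \<bar>u t\<bar> \<le> M)"

definition jet_norm :: "real set \<Rightarrow> nat \<Rightarrow> (real \<Rightarrow> real) \<Rightarrow> real \<Rightarrow> real" where
  "jet_norm I k y s = L2_set (\<lambda>j. sig_deriv I j y s) {..k}"

text \<open>The essential supremum over \<open>[a,b]\<close> of a signal's norm \<open>w\<close>. On a degenerate
  interval every property holds almost everywhere, so there the value of \<open>w\<close> is taken;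
  for a continuous \<open>w\<close> this makes the result the maximum of \<open>w\<close> over \<open>[a,b]\<close> in both
  cases. The conversion to a real number loses nothing when the essential supremum is finite,
  in particular when \<open>w\<close> is continuous on \<open>[a,b]\<close>.\<close>

definition ess_sup_on :: "real \<Rightarrow> real \<Rightarrow> (real \<Rightarrow> real) \<Rightarrow> real" where
  "ess_sup_on a b w =
     (if a < b then real_of_ereal (esssup (lebesgue_on {a..b}) (\<lambda>s. ereal (w s))) else w a)"

text \<open>The domain \<open>[0,T)\<close> of a solution, with \<open>T = \<infinity>\<close> allowed.\<close>

definition time_dom :: "ereal \<Rightarrow> real set" where
  "time_dom T = {t. 0 \<le> t \<and> ereal t < T}"

text \<open>Caratheodory solutions: locally absolutely continuous \<open>x\<close> with
  \<open>x' = f x u\<close> almost everywhere, in integral form.\<close>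

definition solution ::
    "(real^'n \<Rightarrow> real \<Rightarrow> real^'n) \<Rightarrow> (real \<Rightarrow> real) \<Rightarrow> ereal \<Rightarrow> (real \<Rightarrow> real^'n) \<Rightarrow> bool" where
  "solution f u T x \<longleftrightarrow> 0 < T \<and>
     (\<forall>t\<in>time_dom T. set_integrable lebesgue {0..t} (\<lambda>s. f (x s) (u s)) \<and>
        x t = x 0 + (LINT s:{0..t}|lebesgue. f (x s) (u s)))"

definition maximal_solution ::
    "(real^'n \<Rightarrow> real \<Rightarrow> real^'n) \<Rightarrow> (real \<Rightarrow> real) \<Rightarrow> ereal \<Rightarrow> (real \<Rightarrow> real^'n) \<Rightarrow> bool" where
  "maximal_solution f u T x \<longleftrightarrow> solution f u T x \<and>
     \<not> (\<exists>T' z. T < T' \<and> solution f u T' z \<and> (\<forall>t\<in>time_dom T. z t = x t))"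

text \<open>The arguments \<open>(u\<^sub>0,\<dots>,u\<^sub>k\<^sub>-\<^sub>1)\<close> of \<open>H f h k\<close> are the first \<open>k\<close> entries of a sequence;
  the remaining entries are irrelevant.\<close>

primrec H ::
    "(real^'n \<Rightarrow> real \<Rightarrow> real^'n) \<Rightarrow> (real^'n \<Rightarrow> real) \<Rightarrow> nat \<Rightarrow> real^'n \<Rightarrow> (nat \<Rightarrow> real) \<Rightarrow> real"
  where
  "H f h 0 = (\<lambda>x u. h x)"
| "H f h (Suc k) = (\<lambda>x u.
     frechet_derivative (\<lambda>z. H f h k z u) (at x) (f x (u 0)) +
     (\<Sum>j<k. deriv (\<lambda>s. H f h k x (u(j := s))) (u j) * u (Suc j)))"

text \<open>The norm on the left-hand side is the Euclidean norm of the stacked vector,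
  \<open>norm (u, x) = sqrt (u\<^sup>2 + (norm x)\<^sup>2)\<close>.\<close>

definition output_input_stable ::
    "(real^'n \<Rightarrow> real \<Rightarrow> real^'n) \<Rightarrow> (real^'n \<Rightarrow> real) \<Rightarrow> nat \<Rightarrow> bool" where
  "output_input_stable f h N \<longleftrightarrow> 0 < N \<and>
     (\<exists>\<beta> \<gamma>. class_KL \<beta> \<and> class_K_inf \<gamma> \<and>
       (\<forall>u T x. C_sig {0..} (N - 1) u \<longrightarrow> maximal_solution f u T x \<longrightarrow>
         (\<forall>t\<in>time_dom T.
            norm (u t, x t) \<le>
              \<beta> (norm (x 0)) t + \<gamma> (ess_sup_on 0 t (jet_norm (time_dom T) N (\<lambda>s. h (x s)))))))"

definition has_relative_degree ::
    "(real^'n \<Rightarrow> real \<Rightarrow> real^'n) \<Rightarrow> (real^'n \<Rightarrow> real) \<Rightarrow> nat \<Rightarrow> bool" where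
  "has_relative_degree f h r \<longleftrightarrow> 0 < r \<and>
     (\<forall>k<r. \<forall>x u v. H f h k x u = H f h k x v) \<and>
     (\<exists>\<rho>\<^sub>1 \<rho>\<^sub>2. class_K_inf \<rho>\<^sub>1 \<and> class_K_inf \<rho>\<^sub>2 \<and>
       (\<forall>x u. \<bar>u 0\<bar> \<le> \<rho>\<^sub>1 (norm x) + \<rho>\<^sub>2 \<bar>H f h r x u\<bar>))"

definition detectability_input :: "nat \<Rightarrow> (real \<Rightarrow> real) \<Rightarrow> bool" where
  "detectability_input k u \<longleftrightarrow> (case k of 0 \<Rightarrow> admissible_input u | Suc m \<Rightarrow> C_sig {0..} m u)"

definition weakly_uniformly_0_detectable ::
    "(real^'n \<Rightarrow> real \<Rightarrow> real^'n) \<Rightarrow> (real^'n \<Rightarrow> real) \<Rightarrow> nat \<Rightarrow> bool" where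
  "weakly_uniformly_0_detectable f h k \<longleftrightarrow>
     (\<exists>\<beta> \<gamma>. class_KL \<beta> \<and> class_K_inf \<gamma> \<and>
       (\<forall>u T x. detectability_input k u \<longrightarrow> maximal_solution f u T x \<longrightarrow>
         (\<forall>t\<in>time_dom T.
            norm (x t) \<le>
              \<beta> (norm (x 0)) t + \<gamma> (ess_sup_on 0 t (jet_norm (time_dom T) k (\<lambda>s. h (x s)))))))"

end

(*
The chain rule gives y^(j) = H_j(x, u, ..., u^(j-1)) along solutions.

Parts 1 and 2: in the presence of relative degree r, u is bounded by |x| and |y^(r)|, and a
bound on (u, x) contains one on x.

Part 3 uses the stability estimate at t = 0 only. Since the derivatives u_0, ..., u_(N-1) of the
input at 0 are arbitrary, it reads
  |(u_0, x)| <= alpha(|x|) + gamma(|(H_0, ..., H_N)(x, u_0, ..., u_(N-1))|).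
Let r be the least k such that H_k depends on the input; the estimate forces r <= N. For j >= 1,
H_(r+j) is affine in u_j with slope dH_r/du_0 (x, u_0), so where this slope is nonzero the
functions H_(r+1), ..., H_N can be made to vanish, leaving an estimate in terms of H_0, ..., H_r.
By analyticity and continuity it persists for every x in the closure of the set S of those x for
which H_r(x, .) is not constant. The estimate is incompatible with H_r(x, .) being constant, so S
is open, closed and nonempty, hence everything. As H_0, ..., H_(r-1) are functions of x alone that
vanish at 0, the estimate is the one required of a relative degree.
*)

theory Submission
  imports Defs "HOL-Complex_Analysis.Cauchy_Integral_Formula"
begin

section \<open>Calculus of smooth functions\<close>

text \<open>A stability estimate over maximal solutions is empty for an initial state from which
  none starts, so their existence has to be proved before the estimate can be read at time 0. There
  the essential supremum runs over a degenerate interval and is a point value, and polynomial inputs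
  realise all choices of u_0, ..., u_(N-1). Analyticity enters as follows: if the slope of H_r(x, .)
  vanished on an interval, H_r(x, .) would be constant on the whole line. Hence for x in S the
  inputs with nonzero slope are dense, and the estimate, being a closed condition on (x, u_0), holds
  for all u_0. If H_r(x, .) is constant, the right-hand side no longer depends on u_0 while the
  left-hand side is unbounded in u_0. The equilibrium conditions give H_j(0, 0) = 0, which is what
  allows the sum of the |H_j(x)| with j < r to be bounded by a class K function of |x|: such a
  function vanishes at 0.\<close>

lemma C_k_imp_continuous: "C_k k g \<Longrightarrow> continuous_on UNIV g"
  by (cases k) (auto simp: differentiable_imp_continuous_on differentiable_on_def)

lemma C_k_SucD: "C_k (Suc k) g \<Longrightarrow> C_k k g"
proof (induction k arbitrary: g)
  case 0
  then show ?case using C_k_imp_continuous by fastforce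
next
  case (Suc k)
  then show ?case by (meson C_k.simps(2))
qed

lemma C_k_const [simp]: "C_k k (\<lambda>_. c)"
  by (induction k arbitrary: c) auto

lemma C_k_add: "C_k k g1 \<Longrightarrow> C_k k g2 \<Longrightarrow> C_k k (\<lambda>x. g1 x + g2 x)"
proof (induction k arbitrary: g1 g2)
  case 0
  then show ?case by (auto intro: continuous_on_add)
next
  case (Suc k)
  have "frechet_derivative (\<lambda>x. g1 x + g2 x) (at x) =
      (\<lambda>v. frechet_derivative g1 (at x) v + frechet_derivative g2 (at x) v)" for x
    using Suc.prems by (intro frechet_derivative_at[symmetric] has_derivative_add)
      (auto simp: frechet_derivative_works)
  then show ?case using Suc by (auto intro!: differentiable_add)
qed

lemma C_k_sum: "(\<And>i. i \<in> A \<Longrightarrow> C_k k (g i)) \<Longrightarrow> C_k k (\<lambda>x. \<Sum>i\<in>A. g i x)"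
  by (induction A rule: infinite_finite_induct) (auto intro: C_k_add)

lemma C_k_mult:
  fixes g1 g2 :: "'a::real_normed_vector \<Rightarrow> real"
  shows "C_k k g1 \<Longrightarrow> C_k k g2 \<Longrightarrow> C_k k (\<lambda>x. g1 x * g2 x)"
proof (induction k arbitrary: g1 g2)
  case 0
  then show ?case by (auto intro: continuous_on_mult)
next
  case (Suc k)
  have "frechet_derivative (\<lambda>x. g1 x * g2 x) (at x) =
      (\<lambda>v. g1 x * frechet_derivative g2 (at x) v + frechet_derivative g1 (at x) v * g2 x)" for x
    using Suc.prems by (intro frechet_derivative_at[symmetric] has_derivative_mult)
      (auto simp: frechet_derivative_works)
  moreover have "C_k k g1" "C_k k g2"
    using Suc.prems C_k_SucD by blast+
  ultimately show ?case using Suc.IH Suc.prems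
    by (auto intro!: differentiable_mult C_k_add)
qed

text \<open>Linear inner maps are what the recursion for \<open>H\<close> produces: projections,
  evaluation of a sequence at an index, and truncation.\<close>

lemma C_k_compose_linear:
  assumes "bounded_linear L"
  shows "C_k k g \<Longrightarrow> C_k k (\<lambda>x. g (L x))"
proof (induction k arbitrary: g)
  case 0
  then show ?case
    by (auto intro: continuous_on_compose2[where t = UNIV] linear_continuous_on assms)
next
  case (Suc k)
  have *: "((\<lambda>x. g (L x)) has_derivative (\<lambda>v. frechet_derivative g (at (L x)) (L v))) (at x)" for x
    using Suc.prems
    by (intro has_derivative_compose[where f = L, OF bounded_linear_imp_has_derivative[OF assms]])
      (auto simp: frechet_derivative_works)
  then have "frechet_derivative (\<lambda>x. g (L x)) (at x) = (\<lambda>v. frechet_derivative g (at (L x)) (L v))" for x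
    using frechet_derivative_at by metis
  moreover have "C_k k (\<lambda>x. frechet_derivative g (at (L x)) (L v))" for v
    using Suc.IH[of "\<lambda>x. frechet_derivative g (at x) (L v)"] Suc.prems by simp
  ultimately show ?case using * by (auto simp: differentiable_def)
qed

lemma C_k_linear_compose:
  assumes "bounded_linear L"
  shows "C_k k g \<Longrightarrow> C_k k (\<lambda>x. L (g x))"
proof (induction k arbitrary: g)
  case 0
  then show ?case
    by (auto intro: bounded_linear.continuous_on assms)
next
  case (Suc k)
  have *: "((\<lambda>x. L (g x)) has_derivative (\<lambda>v. L (frechet_derivative g (at x) v))) (at x)" for x
    using Suc.prems
    by (intro bounded_linear.has_derivative[OF assms]) (auto simp: frechet_derivative_works)
  then have "frechet_derivative (\<lambda>x. L (g x)) (at x) = (\<lambda>v. L (frechet_derivative g (at x) v))" for x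
    using frechet_derivative_at by metis
  with Suc * show ?case by (auto simp: differentiable_def)
qed

lemma C_k_linear: "bounded_linear L \<Longrightarrow> C_k k L"
  by (cases k) (auto simp: linear_continuous_on bounded_linear_imp_differentiable
      frechet_derivative_at[OF bounded_linear_imp_has_derivative, symmetric])

lemma C_infinity_imp_continuous: "C_infinity g \<Longrightarrow> continuous_on UNIV g"
  using C_k_imp_continuous unfolding C_infinity_def by blast

lemma C_infinity_has_derivative:
  "C_infinity g \<Longrightarrow> (g has_derivative frechet_derivative g (at x)) (at x)"
  unfolding C_infinity_def by (metis C_k.simps(2) frechet_derivative_works)

lemma C_infinity_frechet_derivative: "C_infinity g \<Longrightarrow> C_infinity (\<lambda>x. frechet_derivative g (at x) v)"
  unfolding C_infinity_def by (metis C_k.simps(2))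

lemma C_infinity_add: "C_infinity p \<Longrightarrow> C_infinity q \<Longrightarrow> C_infinity (\<lambda>x. p x + q x)"
  by (simp add: C_infinity_def C_k_add)

lemma C_infinity_sum: "(\<And>i. i \<in> A \<Longrightarrow> C_infinity (g i)) \<Longrightarrow> C_infinity (\<lambda>x. \<Sum>i\<in>A. g i x)"
  by (simp add: C_infinity_def C_k_sum)

lemma C_infinity_compose_linear: "C_infinity g \<Longrightarrow> bounded_linear L \<Longrightarrow> C_infinity (\<lambda>x. g (L x))"
  by (simp add: C_infinity_def C_k_compose_linear)

lemma C_infinity_linear_compose: "C_infinity g \<Longrightarrow> bounded_linear L \<Longrightarrow> C_infinity (\<lambda>x. L (g x))"
  by (simp add: C_infinity_def C_k_linear_compose)

lemma C_infinity_linear: "bounded_linear L \<Longrightarrow> C_infinity L"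
  by (simp add: C_infinity_def C_k_linear)

lemma C_infinity_mult:
  fixes p q :: "'a::real_normed_vector \<Rightarrow> real"
  shows "C_infinity p \<Longrightarrow> C_infinity q \<Longrightarrow> C_infinity (\<lambda>x. p x * q x)"
  by (simp add: C_infinity_def C_k_mult)

section \<open>Smoothness of the functions H and the chain rule\<close>

text \<open>The functions \<open>H f h k\<close> take arbitrary sequences as arguments, which carry no norm. The
  bounded sequences are a normed space that contains the arguments of all of them, whatever \<open>k\<close>.\<close>

definition unit_seq :: "nat \<Rightarrow> nat \<Rightarrow>\<^sub>C real" where
  "unit_seq j = Bcontfun (\<lambda>i. if i = j then 1 else 0)"

text \<open>Truncation turns an arbitrary, possibly unbounded, sequence into a bounded one with the
  same first \<open>k\<close> entries, on which it depends linearly.\<close>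

definition trunc :: "nat \<Rightarrow> (nat \<Rightarrow> real) \<Rightarrow> nat \<Rightarrow>\<^sub>C real" where
  "trunc k u = (\<Sum>j<k. u j *\<^sub>R unit_seq j)"

lemma apply_unit_seq: "apply_bcontfun (unit_seq j) i = (if i = j then 1 else 0)"
  unfolding unit_seq_def
  by (subst Bcontfun_inverse) (auto intro!: bcontfun_normI[where b = 1])

lemma apply_sum_bcontfun:
  fixes g :: "'i \<Rightarrow> 'a::topological_space \<Rightarrow>\<^sub>C 'b::real_normed_vector"
  shows "apply_bcontfun (\<Sum>i\<in>A. g i) x = (\<Sum>i\<in>A. apply_bcontfun (g i) x)"
  by (induction A rule: infinite_finite_induct) auto

lemma apply_trunc: "apply_bcontfun (trunc k u) i = (if i < k then u i else 0)"
  unfolding trunc_def by (simp add: apply_sum_bcontfun apply_unit_seq if_distrib cong: if_cong)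

lemma bounded_linear_apply_bcontfun: "bounded_linear (\<lambda>v. apply_bcontfun v x)"
  by (rule bounded_linear_intro[where K = 1]) (auto intro: norm_bounded)

lemma bounded_linear_trunc: "bounded_linear (\<lambda>v. trunc k (apply_bcontfun v))"
  unfolding trunc_def
  by (intro bounded_linear_sum bounded_linear_scaleR_const bounded_linear_apply_bcontfun)

lemma trunc_upd:
  assumes "j < k"
  shows "trunc k (u(j := s)) = trunc k u + (s - u j) *\<^sub>R unit_seq j"
  by (rule bcontfun_eqI) (use assms in \<open>auto simp: apply_trunc apply_unit_seq\<close>)

definition Hs ::
    "(real^'n \<Rightarrow> real \<Rightarrow> real^'n) \<Rightarrow> (real^'n \<Rightarrow> real) \<Rightarrow> nat \<Rightarrow> (real^'n) \<times> (nat \<Rightarrow>\<^sub>C real) \<Rightarrow> real" where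
  "Hs f h k p = H f h k (fst p) (apply_bcontfun (snd p))"

lemma H_cong: "(\<And>i. i < k \<Longrightarrow> u i = v i) \<Longrightarrow> H f h k x u = H f h k x v"
proof (induction k arbitrary: x u v)
  case (Suc k)
  have 1: "H f h k z u = H f h k z v" for z
    using Suc.prems by (intro Suc.IH) auto
  have 2: "deriv (\<lambda>s. H f h k x (u(j := s))) (u j) = deriv (\<lambda>s. H f h k x (v(j := s))) (v j)"
    if "j < k" for j
  proof -
    have "H f h k x (u(j := s)) = H f h k x (v(j := s))" for s
      using Suc.prems by (intro Suc.IH) auto
    with Suc.prems that show ?thesis by simp
  qed
  from 1 2 Suc.prems show ?case by simp
qed simp

lemma H_eq_Hs: "H f h k x u = Hs f h k (x, trunc k u)"
  unfolding Hs_def by (auto simp: apply_trunc intro: H_cong)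

text \<open>The recursion for \<open>H\<close> mixes separate partial derivatives. Both kinds are
  values of one total derivative of \<open>Hs\<close>, in the directions (f, 0) and (0, e_j);
  smoothness and the chain rule are proved from this form.\<close>

lemma H_Suc:
  assumes "C_infinity (Hs f h k)"
  shows "H f h (Suc k) x u = frechet_derivative (Hs f h k) (at (x, trunc k u)) (f x (u 0), 0) +
    (\<Sum>j<k. frechet_derivative (Hs f h k) (at (x, trunc k u)) (0, unit_seq j) * u (Suc j))"
proof -
  let ?D = "frechet_derivative (Hs f h k) (at (x, trunc k u))"
  have D: "(Hs f h k has_derivative ?D) (at (x, trunc k u))"
    by (rule C_infinity_has_derivative[OF assms])
  have "((\<lambda>z. Hs f h k (z, trunc k u)) has_derivative (\<lambda>v. ?D (v, 0))) (at x)"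
    by (rule has_derivative_compose[where f = "\<lambda>z. (z, trunc k u)", OF _ D])
      (auto intro!: derivative_eq_intros)
  then have 1: "frechet_derivative (\<lambda>z. H f h k z u) (at x) = (\<lambda>v. ?D (v, 0))"
    unfolding H_eq_Hs using frechet_derivative_at by metis
  have 2: "deriv (\<lambda>s. H f h k x (u(j := s))) (u j) = ?D (0, unit_seq j)" if "j < k" for j
  proof -
    have "((\<lambda>s. Hs f h k (x, trunc k u + (s - u j) *\<^sub>R unit_seq j)) has_derivative
        (\<lambda>s. ?D (0, s *\<^sub>R unit_seq j))) (at (u j))"
      by (rule has_derivative_compose[where f = "\<lambda>s. (x, trunc k u + (s - u j) *\<^sub>R unit_seq j)"])
        (use D in \<open>auto intro!: derivative_eq_intros\<close>)
    also have "(\<lambda>s. ?D (0, s *\<^sub>R unit_seq j)) = (\<lambda>s. s * ?D (0, unit_seq j))"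
    proof
      fix s
      show "?D (0, s *\<^sub>R unit_seq j) = s * ?D (0, unit_seq j)"
        using linear_scale[OF has_derivative_linear[OF D], of s "(0, unit_seq j)"] by simp
    qed
    finally have "((\<lambda>s. H f h k x (u(j := s))) has_field_derivative ?D (0, unit_seq j)) (at (u j))"
      unfolding H_eq_Hs trunc_upd[OF that] has_field_derivative_def
      by (simp add: mult.commute[of _ "?D (0, unit_seq j)"])
    then show ?thesis by (rule DERIV_imp_deriv)
  qed
  from 1 2 show ?thesis by simp
qed

lemma C_infinity_Hs:
  fixes f :: "real^'n \<Rightarrow> real \<Rightarrow> real^'n"
  assumes f: "C_infinity (\<lambda>(x, u). f x u)" and h: "C_infinity h"
  shows "C_infinity (Hs f h k)"
proof (induction k)
  case 0
  have "Hs f h 0 = (\<lambda>p. h (fst p))" by (simp add: Hs_def fun_eq_iff)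
  then show ?case using C_infinity_compose_linear[OF h bounded_linear_fst] by simp
next
  case (Suc k)
  define L :: "(real^'n) \<times> (nat \<Rightarrow>\<^sub>C real) \<Rightarrow> _" where "L = (\<lambda>p. (fst p, trunc k (apply_bcontfun (snd p))))"
  define F where "F = (\<lambda>p :: (real^'n) \<times> (nat \<Rightarrow>\<^sub>C real). f (fst p) (apply_bcontfun (snd p) 0))"
  let ?D = "\<lambda>p. frechet_derivative (Hs f h k) (at (L p))"
  have L: "bounded_linear L"
    unfolding L_def
    by (intro bounded_linear_Pair bounded_linear_fst
        bounded_linear_compose[OF bounded_linear_trunc bounded_linear_snd])
  have u: "bounded_linear (\<lambda>p :: (real^'n) \<times> (nat \<Rightarrow>\<^sub>C real). apply_bcontfun (snd p) i)" for i
    by (rule bounded_linear_compose[OF bounded_linear_apply_bcontfun bounded_linear_snd])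
  have F: "C_infinity (\<lambda>p. F p \<bullet> i)" for i
    using C_infinity_linear_compose[OF C_infinity_compose_linear[OF f
        bounded_linear_Pair[OF bounded_linear_fst u[of 0]]] bounded_linear_inner_left[of i]]
    by (simp add: F_def)
  have D: "C_infinity (\<lambda>p. ?D p v)" for v
    by (rule C_infinity_compose_linear[OF C_infinity_frechet_derivative[OF Suc] L])
  \<comment> \<open>\<open>C_infinity\<close> gives smoothness of a derivative in a fixed direction,
    but the direction \<open>F p\<close> varies with \<open>p\<close>. Expanding it in the basis
    leaves sums of products of smooth scalar functions.\<close>
  have "Hs f h (Suc k) p = (\<Sum>i\<in>Basis. (F p \<bullet> i) * ?D p (i, 0)) +
      (\<Sum>j<k. ?D p (0, unit_seq j) * apply_bcontfun (snd p) (Suc j))" for p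
  proof -
    have lin: "linear (?D p)"
      using C_infinity_has_derivative[OF Suc] has_derivative_linear by blast
    have "(F p, 0) = (\<Sum>i\<in>Basis. (F p \<bullet> i) *\<^sub>R (i, 0 :: nat \<Rightarrow>\<^sub>C real))"
      by (simp add: prod_eq_iff fst_sum snd_sum euclidean_representation)
    then have "?D p (F p, 0) = ?D p (\<Sum>i\<in>Basis. (F p \<bullet> i) *\<^sub>R (i, 0))"
      by simp
    also have "\<dots> = (\<Sum>i\<in>Basis. (F p \<bullet> i) * ?D p (i, 0))"
      by (simp add: linear_sum[OF lin] linear_scale[OF lin] del: scaleR_Pair)
    finally show ?thesis
      by (simp add: Hs_def H_Suc[OF Suc] F_def L_def del: H.simps)
  qed
  then have "Hs f h (Suc k) = (\<lambda>p. (\<Sum>i\<in>Basis. (F p \<bullet> i) * ?D p (i, 0)) +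
      (\<Sum>j<k. ?D p (0, unit_seq j) * apply_bcontfun (snd p) (Suc j)))"
    by blast
  then show ?case
    by (simp only:) (intro C_infinity_add C_infinity_sum C_infinity_mult C_infinity_linear F D u)
qed

section \<open>Time domains and one-sided derivatives of signals\<close>

text \<open>The domain is open on the right, so an interval to the right of \<open>t\<close> lies in
  it. This makes derivatives within the domain unique, also at 0.\<close>

lemma at_within_time_dom:
  assumes "t \<in> time_dom T"
  shows "at t within time_dom T \<noteq> bot"
proof -
  from assms obtain d where d: "t < d" "ereal d < T"
    using ereal_dense2[of t T] by (auto simp: time_dom_def)
  then have "{t..d} \<subseteq> time_dom T"
    using assms by (auto simp: time_dom_def intro: le_less_trans[of _ "ereal d"])
  moreover have "at t within {t..d} \<noteq> bot"
    using d by (simp add: trivial_limit_within islimpt_Icc)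
  ultimately show ?thesis
    using at_le bot.extremum_uniqueI by metis
qed

lemma time_dom_PInf: "time_dom \<infinity> = {0..}"
  by (auto simp: time_dom_def)

lemma time_dom_subset: "time_dom T \<subseteq> {0..}"
  by (auto simp: time_dom_def)

lemma atLeastAtMost_subset_time_dom: "t \<in> time_dom T \<Longrightarrow> {0..t} \<subseteq> time_dom T"
  by (auto simp: time_dom_def intro: le_less_trans[of _ "ereal t"])

lemma sig_deriv_0 [simp]: "sig_deriv I 0 y = y"
  by (simp add: sig_deriv_def)

lemma sig_deriv_Suc:
  assumes "t \<in> time_dom T" "\<And>s. s \<in> time_dom T \<Longrightarrow> sig_deriv (time_dom T) j y s = g s"
    "(g has_vector_derivative g') (at t within time_dom T)"
  shows "sig_deriv (time_dom T) (Suc j) y t = g'"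
    and "sig_deriv (time_dom T) j y differentiable (at t within time_dom T)"
proof -
  have *: "(sig_deriv (time_dom T) j y has_vector_derivative g') (at t within time_dom T)"
    by (rule has_vector_derivative_transform[OF assms(1) _ assms(3)]) (simp add: assms(2))
  show "sig_deriv (time_dom T) (Suc j) y t = g'"
    using vector_derivative_within[OF at_within_time_dom[OF assms(1)] *] by (simp add: sig_deriv_def)
  show "sig_deriv (time_dom T) j y differentiable (at t within time_dom T)"
    using * by (rule differentiableI_vector)
qed

lemma C_sig_has_vector_derivative:
  assumes "C_sig {0..} m u" "j < m" "0 \<le> t"
  shows "(sig_deriv {0..} j u has_vector_derivative sig_deriv {0..} (Suc j) u t) (at t within {0..})"
  using assms unfolding C_sig_def
  by (auto simp: sig_deriv_def vector_derivative_works)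

lemma C_sig_continuous:
  assumes "C_sig {0..} m u" "j \<le> m"
  shows "continuous_on {0..} (sig_deriv {0..} j u)"
proof (cases "j = m")
  case True
  with assms show ?thesis by (simp add: C_sig_def)
next
  case False
  with assms show ?thesis
    by (auto simp: C_sig_def intro!: differentiable_imp_continuous_on simp: differentiable_on_def)
qed

lemma C_sig_mono:
  assumes "C_sig {0..} m u" "k \<le> m"
  shows "C_sig {0..} k u"
  using assms C_sig_continuous[OF assms] by (auto simp: C_sig_def)

text \<open>Serves detectability of order 0, whose inputs are the admissible ones.\<close>

lemma C_sig_admissible:
  assumes "C_sig {0..} m u"
  shows "admissible_input u"
  unfolding admissible_input_def
proof (intro conjI allI impI)
  have u: "continuous_on {0..} u"
    using C_sig_continuous[OF assms, of 0] by simp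
  then show "u \<in> borel_measurable (lebesgue_on {0..})"
    by (rule continuous_imp_measurable_on_sets_lebesgue) simp
  fix b :: real
  have "compact (u ` {0..b})"
    by (intro compact_continuous_image continuous_on_subset[OF u]) auto
  then obtain M where "\<forall>t\<in>{0..b}. \<bar>u t\<bar> \<le> M"
    using compact_imp_bounded[of "u ` {0..b}"] by (force simp: bounded_real)
  then have "AE t in lebesgue_on {0..b}. \<bar>u t\<bar> \<le> M"
    by (intro AE_I2) simp
  then show "\<exists>M. AE t in lebesgue_on {0..b}. \<bar>u t\<bar> \<le> M" ..
qed

section \<open>Regularity of solutions and derivatives of the output\<close>

lemma solution_integral:
  fixes x :: "real \<Rightarrow> real^'n"
  assumes "solution f u T x" "t \<in> time_dom T"
  shows "(\<lambda>s. f (x s) (u s)) integrable_on {0..t}"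
    and "x t = x 0 + integral {0..t} (\<lambda>s. f (x s) (u s))"
proof -
  from assms have "set_integrable lebesgue {0..t} (\<lambda>s. f (x s) (u s))"
    and *: "x t = x 0 + (LINT s:{0..t}|lebesgue. f (x s) (u s))"
    unfolding solution_def by simp_all
  note int = set_lebesgue_integral_eq_integral[OF this(1)]
  show "(\<lambda>s. f (x s) (u s)) integrable_on {0..t}" by (rule int)
  show "x t = x 0 + integral {0..t} (\<lambda>s. f (x s) (u s))" using * int(2) by simp
qed

lemma solution_continuous:
  fixes x :: "real \<Rightarrow> real^'n"
  assumes "solution f u T x"
  shows "continuous_on (time_dom T) x"
  unfolding continuous_on_eq_continuous_within
proof
  fix t assume t: "t \<in> time_dom T"
  \<comment> \<open>With \<open>d\<close> strictly after \<open>t\<close> and inside the domain,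
    {0..d} is a neighbourhood of \<open>t\<close> relative to the domain.\<close>
  from t obtain d where d: "t < d" "ereal d < T"
    using ereal_dense2[of t T] by (auto simp: time_dom_def)
  with t have "0 \<le> t" "d \<in> time_dom T" by (auto simp: time_dom_def)
  have eq: "x s = x 0 + integral {0..s} (\<lambda>s. f (x s) (u s))" if "s \<in> {0..d}" for s
    using that atLeastAtMost_subset_time_dom[OF \<open>d \<in> time_dom T\<close>]
    by (intro solution_integral(2)[OF assms]) auto
  have "(\<lambda>s. f (x s) (u s)) integrable_on {0..d}"
    by (rule solution_integral(1)[OF assms \<open>d \<in> time_dom T\<close>])
  then have "continuous_on {0..d} (\<lambda>s. x 0 + integral {0..s} (\<lambda>s. f (x s) (u s)))"
    by (intro continuous_intros indefinite_integral_continuous_1)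
  then have "continuous_on {0..d} x"
    by (rule continuous_on_eq) (rule eq[symmetric])
  then have "continuous (at t within {0..d}) x"
    using \<open>0 \<le> t\<close> d by (auto simp: continuous_on_eq_continuous_within)
  moreover have "at t within {0..d} = at t within time_dom T"
    by (rule at_within_nhd[of _ "{..<d}"])
      (use d atLeastAtMost_subset_time_dom[OF \<open>d \<in> time_dom T\<close>] in \<open>auto simp: time_dom_def\<close>)
  ultimately show "continuous (at t within time_dom T) x" by simp
qed

text \<open>A continuous input makes the integrand continuous, so the fundamental theorem of
  calculus turns a Caratheodory solution into a classical one.\<close>

lemma solution_has_vector_derivative:
  fixes x :: "real \<Rightarrow> real^'n"
  assumes sol: "solution f u T x" and f: "continuous_on UNIV (\<lambda>(x, u). f x u)"
    and u: "continuous_on {0..} u" and t: "t \<in> time_dom T"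
  shows "(x has_vector_derivative f (x t) (u t)) (at t within time_dom T)"
proof -
  from t obtain d where d: "t < d" "ereal d < T"
    using ereal_dense2[of t T] by (auto simp: time_dom_def)
  with t have "0 \<le> t" "d \<in> time_dom T" by (auto simp: time_dom_def)
  note sub = atLeastAtMost_subset_time_dom[OF \<open>d \<in> time_dom T\<close>]
  have eq: "x s = x 0 + integral {0..s} (\<lambda>s. f (x s) (u s))" if "s \<in> {0..d}" for s
    using that sub by (intro solution_integral(2)[OF sol]) auto
  have "continuous_on {0..d} (\<lambda>s. (x s, u s))"
    by (intro continuous_on_Pair continuous_on_subset[OF u]
        continuous_on_subset[OF solution_continuous[OF sol] sub]) auto
  then have "continuous_on {0..d} (\<lambda>s. f (x s) (u s))"
    using continuous_on_compose2[OF f, of "{0..d}" "\<lambda>s. (x s, u s)"] by simp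
  then have "((\<lambda>s. integral {0..s} (\<lambda>s. f (x s) (u s))) has_vector_derivative f (x t) (u t))
      (at t within {0..d})"
    by (rule integral_has_vector_derivative) (use d \<open>0 \<le> t\<close> in auto)
  then have *: "((\<lambda>s. x 0 + integral {0..s} (\<lambda>s. f (x s) (u s))) has_vector_derivative f (x t) (u t))
      (at t within {0..d})"
    using has_vector_derivative_add[OF has_vector_derivative_const] by fastforce
  have "(x has_vector_derivative f (x t) (u t)) (at t within {0..d})"
  proof (rule has_vector_derivative_transform[OF _ _ *])
    show "t \<in> {0..d}" using d \<open>0 \<le> t\<close> by simp
  qed (rule eq)
  moreover have "at t within {0..d} = at t within time_dom T"
    by (rule at_within_nhd[of _ "{..<d}"])
      (use d sub in \<open>auto simp: time_dom_def\<close>)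
  ultimately show ?thesis by simp
qed

text \<open>\<open>U i\<close> plays the i-th derivative of the input. The curve (x, trunc k U) has
  velocity (f, sum of U_(i+1) e_i), and the linear total derivative of \<open>Hs\<close> maps this
  velocity to the summands of \<open>H_Suc\<close>.\<close>

lemma H_has_vector_derivative:
  fixes f :: "real^'n \<Rightarrow> real \<Rightarrow> real^'n"
  assumes f: "C_infinity (\<lambda>(x, u). f x u)" and h: "C_infinity h"
    and x: "(x has_vector_derivative f (x t) (U 0 t)) (at t within I)"
    and U: "\<And>i. i < k \<Longrightarrow> (U i has_vector_derivative U (Suc i) t) (at t within I)"
  shows "((\<lambda>t. H f h k (x t) (\<lambda>i. U i t)) has_vector_derivative
      H f h (Suc k) (x t) (\<lambda>i. U i t)) (at t within I)"
proof -
  let ?p = "\<lambda>t. (x t, trunc k (\<lambda>i. U i t))"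
  let ?p' = "(f (x t) (U 0 t), \<Sum>i<k. U (Suc i) t *\<^sub>R unit_seq i)"
  let ?D = "frechet_derivative (Hs f h k) (at (?p t))"
  note Hs = C_infinity_Hs[OF f h, of k]
  have D: "(Hs f h k has_derivative ?D) (at (?p t))"
    by (rule C_infinity_has_derivative[OF Hs])
  then have lin: "linear ?D" by (rule has_derivative_linear)
  have "((\<lambda>t. trunc k (\<lambda>i. U i t)) has_vector_derivative (\<Sum>i<k. U (Suc i) t *\<^sub>R unit_seq i))
      (at t within I)"
    unfolding trunc_def
    by (intro has_vector_derivative_sum
        bounded_linear.has_vector_derivative[OF bounded_linear_scaleR_left] U) simp
  then have "(?p has_vector_derivative ?p') (at t within I)"
    by (intro has_vector_derivative_Pair x)
  then have "(?p has_derivative (\<lambda>s. s *\<^sub>R ?p')) (at t within I)"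
    by (simp only: has_vector_derivative_def)
  then have "((\<lambda>t. Hs f h k (?p t)) has_derivative (\<lambda>s. ?D (s *\<^sub>R ?p'))) (at t within I)"
    by (rule has_derivative_compose) (rule D)
  moreover have "?D (s *\<^sub>R ?p') = s *\<^sub>R H f h (Suc k) (x t) (\<lambda>i. U i t)" for s
  proof -
    have "?p' = (f (x t) (U 0 t), 0) + (\<Sum>i<k. U (Suc i) t *\<^sub>R (0, unit_seq i))"
      by (simp add: prod_eq_iff fst_sum snd_sum)
    then have "?D ?p' = ?D (f (x t) (U 0 t), 0) + (\<Sum>i<k. U (Suc i) t * ?D (0, unit_seq i))"
      by (simp only: linear_add[OF lin] linear_sum[OF lin] linear_scale[OF lin] real_scaleR_def)
    also have "\<dots> = H f h (Suc k) (x t) (\<lambda>i. U i t)"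
      by (simp add: H_Suc[OF Hs] mult.commute del: H.simps)
    finally show ?thesis by (simp only: linear_scale[OF lin])
  qed
  ultimately show ?thesis
    unfolding has_vector_derivative_def H_eq_Hs[of f h k] by simp
qed

text \<open>One order more than the smoothness of the input is reached because H_j reads the input
  derivatives only up to order j - 1.\<close>

lemma sig_deriv_output:
  fixes f :: "real^'n \<Rightarrow> real \<Rightarrow> real^'n"
  assumes f: "C_infinity (\<lambda>(x, u). f x u)" and h: "C_infinity h"
    and sol: "solution f u T x" and u: "C_sig {0..} m u"
    and "j \<le> Suc m" "t \<in> time_dom T"
  shows "sig_deriv (time_dom T) j (\<lambda>s. h (x s)) t = H f h j (x t) (\<lambda>i. sig_deriv {0..} i u t)"
  using assms(5,6)
proof (induction j arbitrary: t)
  case (Suc j)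
  have u0: "continuous_on {0..} u"
    using C_sig_continuous[OF u, of 0] by simp
  have "(sig_deriv {0..} i u has_vector_derivative sig_deriv {0..} (Suc i) u t) (at t within time_dom T)"
    if "i < j" for i
    using Suc.prems that time_dom_subset[of T]
    by (intro has_vector_derivative_within_subset[OF C_sig_has_vector_derivative[OF u]]) auto
  moreover have "(x has_vector_derivative f (x t) (sig_deriv {0..} 0 u t)) (at t within time_dom T)"
    using solution_has_vector_derivative[OF sol C_infinity_imp_continuous[OF f] u0] Suc.prems by simp
  ultimately have "((\<lambda>t. H f h j (x t) (\<lambda>i. sig_deriv {0..} i u t)) has_vector_derivative
      H f h (Suc j) (x t) (\<lambda>i. sig_deriv {0..} i u t)) (at t within time_dom T)"
    by (intro H_has_vector_derivative[OF f h])
  then show ?case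
    using Suc by (intro sig_deriv_Suc(1)) auto
qed simp

lemma continuous_on_sig_deriv_output:
  fixes f :: "real^'n \<Rightarrow> real \<Rightarrow> real^'n"
  assumes f: "C_infinity (\<lambda>(x, u). f x u)" and h: "C_infinity h"
    and sol: "solution f u T x" and u: "C_sig {0..} m u" and j: "j \<le> Suc m"
  shows "continuous_on (time_dom T) (sig_deriv (time_dom T) j (\<lambda>s. h (x s)))"
proof -
  have "continuous_on (time_dom T) (\<lambda>t. trunc j (\<lambda>i. sig_deriv {0..} i u t))"
    unfolding trunc_def using j
    by (intro continuous_intros continuous_on_subset[OF C_sig_continuous[OF u] time_dom_subset]) auto
  then have "continuous_on (time_dom T) (\<lambda>t. (x t, trunc j (\<lambda>i. sig_deriv {0..} i u t)))"
    by (intro continuous_on_Pair solution_continuous[OF sol])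
  then have "continuous_on (time_dom T) (\<lambda>t. Hs f h j (x t, trunc j (\<lambda>i. sig_deriv {0..} i u t)))"
    by (rule continuous_on_compose2[OF C_infinity_imp_continuous[OF C_infinity_Hs[OF f h]]]) auto
  then show ?thesis
    by (rule continuous_on_eq) (simp add: sig_deriv_output[OF f h sol u j] H_eq_Hs)
qed

section \<open>Essential suprema of continuous signals\<close>

text \<open>If \<open>w s\<close> exceeded the essential supremum, continuity would keep
  \<open>w\<close> above a larger constant on an interval around \<open>s\<close>, which is not a
  null set.\<close>

lemma ess_sup_on_upper:
  assumes w: "continuous_on {a..b} w" and s: "s \<in> {a..b}"
  shows "w s \<le> ess_sup_on a b w"
proof (cases "a < b")
  case False
  with s have "s = a" by simp
  with False show ?thesis by (simp add: ess_sup_on_def)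
next
  case True
  let ?M = "lebesgue_on {a..b}" and ?w = "\<lambda>s. ereal (w s)"
  have meas: "?w \<in> borel_measurable ?M"
    using continuous_imp_measurable_on_sets_lebesgue[OF w] by simp
  have "compact (w ` {a..b})"
    by (intro compact_continuous_image w) auto
  then obtain C where C: "\<forall>t\<in>{a..b}. \<bar>w t\<bar> \<le> C"
    using compact_imp_bounded[of "w ` {a..b}"] by (force simp: bounded_real)
  \<comment> \<open>Excludes the value infinity, which the conversion to a real number would send to
    0.\<close>
  have "esssup ?M ?w \<le> ereal C"
    using C by (intro esssup_I meas AE_I2) (auto simp: abs_le_iff)
  moreover have lower: "ereal (w s) \<le> esssup ?M ?w"
  proof (rule ccontr)
    assume "\<not> ereal (w s) \<le> esssup ?M ?w"
    then obtain c where c: "esssup ?M ?w < ereal c" "c < w s"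
      using ereal_dense2[of "esssup ?M ?w" "ereal (w s)"] by (auto simp: not_le)
    have "AE t in ?M. w t < c"
      using esssup_AE[where M = ?M and f = ?w] by eventually_elim (use c in \<open>auto dest: le_less_trans\<close>)
    then have "AE t in lebesgue. t \<in> {a..b} \<longrightarrow> w t < c"
      by (subst (asm) AE_restrict_space_iff) auto
    then obtain Z where Z: "\<And>t. t \<in> space lebesgue - Z \<Longrightarrow> t \<in> {a..b} \<longrightarrow> w t < c"
        "Z \<in> null_sets lebesgue"
      by (rule AE_E3) (rule that; blast)
    have "{t \<in> {a..b}. \<not> w t < c} \<subseteq> Z"
      using Z(1) by auto
    then have neg: "negligible {t \<in> {a..b}. \<not> w t < c}"
      by (rule negligible_subset[OF Z(2)[folded negligible_iff_null_sets]])
    obtain d where d: "d > 0" "\<And>t. t \<in> {a..b} \<Longrightarrow> dist t s < d \<Longrightarrow> dist (w t) (w s) < w s - c"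
      using w s c(2) unfolding continuous_on_iff by (metis diff_gt_0_iff_gt)
    \<comment> \<open>The interval is cut off at \<open>a\<close> and \<open>b\<close> because
      \<open>s\<close> may be an end point.\<close>
    let ?I = "{max a (s - d)<..<min b (s + d)}"
    have "?I \<subseteq> {t \<in> {a..b}. \<not> w t < c}"
    proof
      fix t assume "t \<in> ?I"
      then have t: "t \<in> {a..b}" "\<bar>t - s\<bar> < d"
        by auto
      then have "\<bar>w t - w s\<bar> < w s - c"
        using d(2) by (simp add: dist_real_def)
      with t show "t \<in> {t \<in> {a..b}. \<not> w t < c}"
        by auto
    qed
    then have "negligible ?I"
      by (rule negligible_subset[OF neg])
    moreover have "max a (s - d) < min b (s + d)"
      using True s d(1) by auto
    then have "?I \<noteq> {}" by (simp only: greaterThanLessThan_empty_iff not_le)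
    ultimately show False
      using open_not_negligible[OF open_greaterThanLessThan] by blast
  qed
  ultimately show ?thesis
    using True by (cases "esssup ?M ?w") (auto simp: ess_sup_on_def)
qed

lemma ess_sup_on_least:
  assumes w: "continuous_on {a..b} w" and "a \<le> b" and C: "\<And>s. s \<in> {a..b} \<Longrightarrow> w s \<le> C"
  shows "ess_sup_on a b w \<le> C"
proof (cases "a < b")
  case False
  with assms show ?thesis by (auto simp: ess_sup_on_def)
next
  case True
  let ?E = "esssup (lebesgue_on {a..b}) (\<lambda>s. ereal (w s))"
  have "?E \<le> ereal C"
    using C continuous_imp_measurable_on_sets_lebesgue[OF w]
    by (intro esssup_I AE_I2) auto
  \<comment> \<open>The conversion would send minus infinity to 0 as well. It is excluded because
    [a,b] has positive measure.\<close>
  moreover have "?E \<noteq> - \<infinity>"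
  proof
    assume "?E = - \<infinity>"
    then have "AE s in lebesgue_on {a..b}. False"
      using esssup_AE[where M = "lebesgue_on {a..b}" and f = "\<lambda>s. ereal (w s)"] by simp
    then have "ae_filter (lebesgue_on {a..b}) = bot"
      by (simp only: trivial_limit_def)
    then have "emeasure (lebesgue_on {a..b}) (space (lebesgue_on {a..b})) = 0"
      by (simp only: ae_filter_eq_bot_iff)
    with True show False by (simp add: emeasure_restrict_space)
  qed
  ultimately show ?thesis
    using True by (cases ?E) (auto simp: ess_sup_on_def)
qed

lemma jet_norm_mono: "k \<le> m \<Longrightarrow> jet_norm I k y s \<le> jet_norm I m y s"
  unfolding jet_norm_def L2_set_def by (intro real_sqrt_le_mono sum_mono2) auto

lemma abs_sig_deriv_le_jet_norm: "j \<le> k \<Longrightarrow> \<bar>sig_deriv I j y s\<bar> \<le> jet_norm I k y s"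
  using member_le_L2_set[of "{..k}" j "\<lambda>j. \<bar>sig_deriv I j y s\<bar>"]
  by (simp add: jet_norm_def L2_set_def)

section \<open>Comparison functions\<close>

lemma class_KI:
  assumes "continuous_on {0..} \<alpha>" "\<And>s t. 0 \<le> s \<Longrightarrow> s < t \<Longrightarrow> \<alpha> s < \<alpha> t" "\<alpha> 0 = 0"
  shows "class_K \<alpha>"
  using assms by (simp add: class_K_def strict_mono_on_def)

lemma class_K_strict_mono: "class_K \<alpha> \<Longrightarrow> 0 \<le> s \<Longrightarrow> s < t \<Longrightarrow> \<alpha> s < \<alpha> t"
  by (simp add: class_K_def strict_mono_on_def)

lemma class_K_mono: "class_K \<alpha> \<Longrightarrow> 0 \<le> s \<Longrightarrow> s \<le> t \<Longrightarrow> \<alpha> s \<le> \<alpha> t"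
  using class_K_strict_mono[of \<alpha> s t] by (cases "s = t") auto

lemma class_K_zero: "class_K \<alpha> \<Longrightarrow> \<alpha> 0 = 0"
  by (simp add: class_K_def)

lemma class_K_continuous: "class_K \<alpha> \<Longrightarrow> continuous_on {0..} \<alpha>"
  by (simp add: class_K_def)

lemma class_K_nonneg: "class_K \<alpha> \<Longrightarrow> 0 \<le> s \<Longrightarrow> 0 \<le> \<alpha> s"
  using class_K_mono[of \<alpha> 0 s] by (simp add: class_K_zero)

lemma class_K_add:
  assumes "class_K \<alpha>1" "class_K \<alpha>2"
  shows "class_K (\<lambda>s. \<alpha>1 s + \<alpha>2 s)"
proof (rule class_KI)
  show "continuous_on {0..} (\<lambda>s. \<alpha>1 s + \<alpha>2 s)"
    by (rule continuous_on_add[OF class_K_continuous[OF assms(1)] class_K_continuous[OF assms(2)]])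
  show "\<alpha>1 s + \<alpha>2 s < \<alpha>1 t + \<alpha>2 t" if "0 \<le> s" "s < t" for s t
    by (rule add_strict_mono[OF class_K_strict_mono[OF assms(1) that] class_K_strict_mono[OF assms(2) that]])
  show "\<alpha>1 0 + \<alpha>2 0 = 0"
    by (simp add: assms class_K_zero)
qed

lemma class_K_compose:
  assumes "class_K \<alpha>1" "class_K \<alpha>2"
  shows "class_K (\<lambda>s. \<alpha>1 (\<alpha>2 s))"
proof (rule class_KI)
  show "continuous_on {0..} (\<lambda>s. \<alpha>1 (\<alpha>2 s))"
    by (rule continuous_on_compose2[OF class_K_continuous[OF assms(1)] class_K_continuous[OF assms(2)]])
      (use class_K_nonneg[OF assms(2)] in auto)
  show "\<alpha>1 (\<alpha>2 s) < \<alpha>1 (\<alpha>2 t)" if "0 \<le> s" "s < t" for s t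
    by (intro class_K_strict_mono[OF assms(1)] class_K_strict_mono[OF assms(2)]
        class_K_nonneg[OF assms(2)] that)
  show "\<alpha>1 (\<alpha>2 0) = 0"
    by (simp add: assms class_K_zero)
qed

lemma class_K_scale: "0 < c \<Longrightarrow> class_K (\<lambda>s. c * s)"
  by (auto intro!: class_KI continuous_intros)

text \<open>The sum is at most twice its larger summand. This splits a class K function over a sum
  in place of subadditivity and is the origin of the factors 2 below.\<close>

lemma class_K_add_le:
  assumes "class_K \<alpha>" "0 \<le> a" "0 \<le> b"
  shows "\<alpha> (a + b) \<le> \<alpha> (2 * a) + \<alpha> (2 * b)"
proof (cases "a \<le> b")
  case True
  then show ?thesis
    using class_K_mono[OF assms(1), of "a + b" "2 * b"] class_K_nonneg[OF assms(1), of "2 * a"] assms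
    by simp
next
  case False
  then show ?thesis
    using class_K_mono[OF assms(1), of "a + b" "2 * a"] class_K_nonneg[OF assms(1), of "2 * b"] assms
    by simp
qed

lemma class_K_inf_D: "class_K_inf \<alpha> \<Longrightarrow> class_K \<alpha>"
  by (simp add: class_K_inf_def)

text \<open>Every new gain is built to lie above a given \<gamma> and inherits unboundedness from
  it.\<close>

lemma class_K_inf_dominate:
  assumes "class_K_inf \<alpha>" "class_K \<alpha>'" "\<And>s. 0 \<le> s \<Longrightarrow> \<alpha> s \<le> \<alpha>' s"
  shows "class_K_inf \<alpha>'"
  unfolding class_K_inf_def
proof
  show "\<not> bdd_above (\<alpha>' ` {0..})"
  proof
    assume "bdd_above (\<alpha>' ` {0..})"
    then obtain M where "\<And>s. 0 \<le> s \<Longrightarrow> \<alpha>' s \<le> M"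
      by (auto simp: bdd_above_def)
    then have "bdd_above (\<alpha> ` {0..})"
      using assms(3) by (intro bdd_aboveI2[where M = M]) (auto intro: order_trans)
    then show False using assms(1) by (simp add: class_K_inf_def)
  qed
qed (rule assms)

lemma class_KL_add:
  assumes "class_KL \<beta>1" "class_KL \<beta>2"
  shows "class_KL (\<lambda>s t. \<beta>1 s t + \<beta>2 s t)"
  using assms unfolding class_KL_def
  by (auto intro!: class_K_add monotone_onI add_mono tendsto_add_zero dest: monotone_onD)

lemma class_KL_compose:
  assumes \<alpha>: "class_K \<alpha>" and \<beta>: "class_KL \<beta>"
  shows "class_KL (\<lambda>s t. \<alpha> (\<beta> s t))"
  unfolding class_KL_def
proof (intro conjI allI impI)
  fix t :: real assume "0 \<le> t"
  then show "class_K (\<lambda>s. \<alpha> (\<beta> s t))"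
    using \<beta> by (intro class_K_compose[OF \<alpha>]) (simp add: class_KL_def)
next
  fix s :: real assume s: "0 \<le> s"
  have nonneg: "0 \<le> \<beta> s t" if "0 \<le> t" for t
    using \<beta> that s class_K_nonneg[of "\<lambda>s. \<beta> s t"] by (simp add: class_KL_def)
  show "antimono_on {0..} (\<lambda>t. \<alpha> (\<beta> s t))"
    using \<beta> s nonneg by (auto simp: class_KL_def intro!: monotone_onI class_K_mono[OF \<alpha>] dest: monotone_onD)
  \<comment> \<open>Continuity of \<alpha> is known only relative to the nonnegative reals, so the
    limit is taken along a filter restricted to them; nonnegativity of \<beta> keeps the inner
    function there.\<close>
  have "continuous (at 0 within {0..}) \<alpha>"
    using \<alpha> by (simp add: class_K_def continuous_on_eq_continuous_within)
  then have "(\<alpha> \<longlongrightarrow> 0) (at 0 within {0..})"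
    using \<alpha> by (simp add: continuous_within class_K_def)
  then have "(\<alpha> \<longlongrightarrow> 0) (inf (nhds 0) (principal {0..}))"
    using \<alpha> by (simp add: tendsto_at_iff_tendsto_nhds_within class_K_def)
  moreover have "filterlim (\<beta> s) (inf (nhds 0) (principal {0..})) at_top"
    unfolding filterlim_inf filterlim_principal
    using \<beta> s nonneg by (auto simp: class_KL_def intro!: eventually_at_top_linorderI[of 0])
  ultimately show "((\<lambda>t. \<alpha> (\<beta> s t)) \<longlongrightarrow> 0) at_top"
    by (rule filterlim_compose)
qed

section \<open>Output-input stability and detectability\<close>

text \<open>Since N is positive, both notions use inputs in \<open>C_sig {0..} (N - 1)\<close>, and
  the same \<beta> and \<gamma> serve.\<close>

lemma output_input_stable_imp_detectable:
  assumes "output_input_stable f h N"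
  shows "weakly_uniformly_0_detectable f h N"
proof -
  from assms obtain m where N: "N = Suc m"
    unfolding output_input_stable_def using gr0_implies_Suc by blast
  have "norm b \<le> c" if "norm (a, b) \<le> c" for a c :: real and b :: "real^'n"
    using that norm_snd_le[of b a] by simp
  with assms show ?thesis
    unfolding output_input_stable_def weakly_uniformly_0_detectable_def detectability_input_def N
      nat.case diff_Suc_1
    by blast
qed

lemma relative_degree_detectable_imp_output_input_stable:
  fixes f :: "real^'n \<Rightarrow> real \<Rightarrow> real^'n"
  assumes f: "C_infinity (\<lambda>(x, u). f x u)" and h: "C_infinity h"
    and r: "has_relative_degree f h r" and k: "weakly_uniformly_0_detectable f h k"
  shows "output_input_stable f h (max r k)"
proof -
  define N where "N = max r k"
  from r have "0 < r" by (simp add: has_relative_degree_def)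
  from r obtain \<rho>1 \<rho>2 where \<rho>: "class_K_inf \<rho>1" "class_K_inf \<rho>2"
    "\<And>x u. \<bar>u 0\<bar> \<le> \<rho>1 (norm x) + \<rho>2 \<bar>H f h r x u\<bar>"
    unfolding has_relative_degree_def by blast
  from k obtain \<beta> \<gamma> where \<beta>: "class_KL \<beta>" and \<gamma>: "class_K_inf \<gamma>"
    and det: "\<And>u T x t. detectability_input k u \<Longrightarrow> maximal_solution f u T x \<Longrightarrow> t \<in> time_dom T \<Longrightarrow>
      norm (x t) \<le> \<beta> (norm (x 0)) t + \<gamma> (ess_sup_on 0 t (jet_norm (time_dom T) k (\<lambda>s. h (x s))))"
    unfolding weakly_uniformly_0_detectable_def by blast
  note \<rho>K = \<rho>(1,2)[THEN class_K_inf_D] and \<gamma>K = class_K_inf_D[OF \<gamma>]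
  \<comment> \<open>Inserting the bound on |x| into |u| <= \<rho>1(|x|) + \<rho>2(|y^(r)|) and
    splitting \<rho>1 with factors 2 bounds |u|; the leading \<beta> and \<gamma> account for |x|
    itself.\<close>
  define \<beta>' where "\<beta>' = (\<lambda>s t. \<beta> s t + \<rho>1 (2 * \<beta> s t))"
  define \<gamma>' where "\<gamma>' = (\<lambda>s. \<gamma> s + (\<rho>1 (2 * \<gamma> s) + \<rho>2 s))"
  have \<beta>': "class_KL \<beta>'"
    unfolding \<beta>'_def
    by (intro class_KL_add \<beta> class_KL_compose[OF class_K_compose[OF \<rho>K(1) class_K_scale]]) simp_all
  have \<gamma>'K: "class_K \<gamma>'"
    unfolding \<gamma>'_def
    by (intro class_K_add \<gamma>K \<rho>K class_K_compose[OF class_K_compose[OF \<rho>K(1) class_K_scale]]) simp_all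
  have \<gamma>': "class_K_inf \<gamma>'"
    by (rule class_K_inf_dominate[OF \<gamma> \<gamma>'K])
      (simp add: \<gamma>'_def add_nonneg_nonneg class_K_nonneg \<rho>K \<gamma>K)
  have "norm (u t, x t) \<le>
      \<beta>' (norm (x 0)) t + \<gamma>' (ess_sup_on 0 t (jet_norm (time_dom T) N (\<lambda>s. h (x s))))"
    if u: "C_sig {0..} (N - 1) u" and x: "maximal_solution f u T x" and t: "t \<in> time_dom T" for u T x t
  proof -
    let ?y = "\<lambda>s. h (x s)"
    define E where "E m = ess_sup_on 0 t (jet_norm (time_dom T) m ?y)" for m
    have "0 \<le> t" using t by (simp add: time_dom_def)
    from x have sol: "solution f u T x" by (simp add: maximal_solution_def)
    \<comment> \<open>Smoothness N - 1 of the input makes the output derivatives continuous exactly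
      up to order N, so the pointwise comparison of jets passes to their essential suprema.\<close>
    have cont: "continuous_on {0..t} (jet_norm (time_dom T) m ?y)" if "m \<le> N" for m
    proof -
      have "j \<le> Suc (N - 1)" if "j \<in> {..m}" for j
        using that \<open>m \<le> N\<close> by simp
      then show ?thesis
        unfolding jet_norm_def L2_set_def
        by (intro continuous_intros
            continuous_on_subset[OF continuous_on_sig_deriv_output[OF f h sol u]
              atLeastAtMost_subset_time_dom[OF t]])
    qed
    have upper: "jet_norm (time_dom T) N ?y s \<le> E N" if "s \<in> {0..t}" for s
      unfolding E_def using cont[of N] that by (intro ess_sup_on_upper) auto
    have E: "E k \<le> E N"
      unfolding E_def[of k]
      using cont[of k] \<open>0 \<le> t\<close>
      by (intro ess_sup_on_least order_trans[OF jet_norm_mono upper]) (auto simp: N_def)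
    have "0 \<le> E k"
      using ess_sup_on_upper[OF cont[of k], of t] \<open>0 \<le> t\<close>
      by (auto simp: E_def N_def jet_norm_def intro: order_trans[OF L2_set_nonneg])
    have yr: "\<bar>H f h r (x t) (\<lambda>i. sig_deriv {0..} i u t)\<bar> \<le> E N"
      using sig_deriv_output[OF f h sol u _ t, of r] abs_sig_deriv_le_jet_norm[of r N "time_dom T" ?y t]
        upper[of t] \<open>0 \<le> t\<close> \<open>0 < r\<close> by (simp add: N_def)
    have "detectability_input k u"
      using C_sig_admissible[OF u] C_sig_mono[OF u]
      by (auto simp: detectability_input_def N_def split: nat.split)
    note det[OF this x t]
    moreover have "\<gamma> (E k) \<le> \<gamma> (E N)"
      by (rule class_K_mono[OF \<gamma>K \<open>0 \<le> E k\<close> E])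
    ultimately have xt: "norm (x t) \<le> \<beta> (norm (x 0)) t + \<gamma> (E N)"
      by (simp add: E_def)
    have nonneg: "0 \<le> \<beta> (norm (x 0)) t" "0 \<le> \<gamma> (E N)"
      using \<beta> \<open>0 \<le> t\<close> class_K_nonneg[of "\<lambda>s. \<beta> s t"] class_K_nonneg[OF \<gamma>K, of "E N"] \<open>0 \<le> E k\<close> E
      by (auto simp: class_KL_def)
    have "\<bar>u t\<bar> \<le> \<rho>1 (norm (x t)) + \<rho>2 \<bar>H f h r (x t) (\<lambda>i. sig_deriv {0..} i u t)\<bar>"
      using \<rho>(3)[of "\<lambda>i. sig_deriv {0..} i u t" "x t"] by simp
    also have "\<dots> \<le> \<rho>1 (\<beta> (norm (x 0)) t + \<gamma> (E N)) + \<rho>2 (E N)"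
      by (intro add_mono class_K_mono[OF \<rho>K(1)] class_K_mono[OF \<rho>K(2)] xt yr) auto
    also have "\<dots> \<le> \<rho>1 (2 * \<beta> (norm (x 0)) t) + \<rho>1 (2 * \<gamma> (E N)) + \<rho>2 (E N)"
      using class_K_add_le[OF \<rho>K(1) nonneg] by simp
    finally have "\<bar>u t\<bar> \<le> \<rho>1 (2 * \<beta> (norm (x 0)) t) + \<rho>1 (2 * \<gamma> (E N)) + \<rho>2 (E N)" .
    then show ?thesis
      using xt norm_Pair_le[of "u t" "x t"] by (simp add: \<beta>'_def \<gamma>'_def E_def)
  qed
  moreover have "0 < N" using \<open>0 < r\<close> by (simp add: N_def)
  ultimately show ?thesis
    unfolding output_input_stable_def N_def[symmetric] using \<beta>' \<gamma>' by blast
qed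

section \<open>Existence of maximal solutions\<close>

text \<open>Derivatives in the basis directions are continuous, hence bounded on \<open>S\<close>;
  their bounds add up to a bound on the operator norm, and the mean value inequality
  applies.\<close>

lemma C_infinity_lipschitz_on_compact:
  fixes g :: "'a::euclidean_space \<Rightarrow> 'b::real_normed_vector"
  assumes g: "C_infinity g" and S: "compact S" "convex S"
  obtains L where "0 \<le> L" "\<And>p q. p \<in> S \<Longrightarrow> q \<in> S \<Longrightarrow> norm (g p - g q) \<le> L * norm (p - q)"
proof -
  let ?D = "\<lambda>p. frechet_derivative g (at p)"
  have "\<exists>C. \<forall>p\<in>S. norm (?D p b) \<le> C" for b
  proof -
    have "compact ((\<lambda>p. ?D p b) ` S)"
      by (intro compact_continuous_image S(1)
          continuous_on_subset[OF C_infinity_imp_continuous[OF C_infinity_frechet_derivative[OF g]]]) simp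
    then show ?thesis
      by (auto dest!: compact_imp_bounded simp: bounded_iff)
  qed
  then obtain C where C: "\<And>b p. p \<in> S \<Longrightarrow> norm (?D p b) \<le> C b" by metis
  \<comment> \<open>The absolute value keeps \<open>L\<close> nonnegative when \<open>S\<close> is
    empty and the bounds \<open>C b\<close> are arbitrary.\<close>
  define L where "L = \<bar>\<Sum>b\<in>Basis. C b\<bar>"
  have "onorm (?D p) \<le> L" if "p \<in> S" for p
    unfolding L_def
    by (intro onorm_componentwise_le order_trans[OF sum_mono abs_ge_self] C that
        has_derivative_bounded_linear[OF C_infinity_has_derivative[OF g]])
  then have "norm (g p - g q) \<le> L * norm (p - q)" if "p \<in> S" "q \<in> S" for p q
    by (intro differentiable_bound[OF S(2) has_derivative_at_withinI[OF C_infinity_has_derivative[OF g]]] that)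
  then show thesis by (intro that[of L]) (auto simp: L_def)
qed

text \<open>Picard-Lindelof: a solution is a fixed point of the integral operator on bounded
  continuous functions, with f precomposed by the projection onto the unit ball around
  \<open>x0\<close> so that global bounds hold.\<close>

lemma local_solution_exists:
  fixes f :: "real^'n \<Rightarrow> real \<Rightarrow> real^'n"
  assumes f: "C_infinity (\<lambda>(x, u). f x u)" and u: "continuous_on {0..} u"
  obtains \<tau> x where "0 < \<tau>" "solution f u (ereal \<tau>) x" "x 0 = x0"
proof -
  let ?f = "\<lambda>(x, u). f x u"
  let ?B = "cball x0 1"
  note fc = C_infinity_imp_continuous[OF f]
  have "compact (u ` {0..1})"
    by (intro compact_continuous_image continuous_on_subset[OF u]) auto
  then obtain m where m: "\<forall>t\<in>{0..1}. \<bar>u t\<bar> \<le> m"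
    by (force dest!: compact_imp_bounded simp: bounded_real)
  let ?K = "?B \<times> {-m..m}"
  have K: "compact ?K" "convex ?K"
    by (auto intro!: compact_Times convex_Times)
  obtain L where L: "0 \<le> L" "\<And>p q. p \<in> ?K \<Longrightarrow> q \<in> ?K \<Longrightarrow> norm (?f p - ?f q) \<le> L * norm (p - q)"
    using C_infinity_lipschitz_on_compact[OF f K] by metis
  have "compact (?f ` ?K)"
    by (rule compact_continuous_image[OF continuous_on_subset[OF fc subset_UNIV] K(1)])
  then obtain M where M: "\<forall>p\<in>?K. norm (?f p) \<le> M"
    by (auto dest!: compact_imp_bounded simp: bounded_iff)
  \<comment> \<open>Makes the operator a contraction (\<open>L * \<tau> < 1\<close>), keeps its
    fixed point in the unit ball (\<open>\<bar>M\<bar> * \<tau> \<le> 1\<close>), and stays within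
    [0,1], where \<open>m\<close> bounds the input.\<close>
  define \<tau> where "\<tau> = 1 / (1 + L + \<bar>M\<bar>)"
  have \<tau>: "0 < \<tau>" "\<tau> \<le> 1" "L * \<tau> < 1" "\<bar>M\<bar> * \<tau> \<le> 1"
    using L(1) by (auto simp: \<tau>_def field_simps)
  define \<pi> where "\<pi> = closest_point ?B"
  have \<pi>: "\<pi> z \<in> ?B" "dist (\<pi> y) (\<pi> z) \<le> dist y z" "continuous_on UNIV \<pi>" for y z
    unfolding \<pi>_def
    by (auto intro!: closest_point_in_set closest_point_lipschitz continuous_on_closest_point
        simp del: mem_cball)
  define g where "g \<phi> s = f (\<pi> (\<phi> s)) (u s)" for \<phi> :: "real \<Rightarrow> real^'n" and s
  have in_K: "(\<pi> y, u s) \<in> ?K" if "s \<in> {0..\<tau>}" for y s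
    using \<pi>(1)[of y] m that \<tau>(2) by (auto simp: abs_le_iff minus_le_iff)
  have g_cont: "continuous_on {0..t} (g \<phi>)" if "continuous_on UNIV \<phi>" "0 \<le> t" for \<phi> t
  proof -
    have "continuous_on {0..t} (\<lambda>s. (\<pi> (\<phi> s), u s))"
      by (intro continuous_on_Pair continuous_on_subset[OF u] continuous_on_compose2[OF \<pi>(3)]
          continuous_on_subset[OF that(1)]) auto
    from continuous_on_compose2[OF fc this] show ?thesis by (simp add: g_def[abs_def])
  qed
  have g_bound: "norm (g \<phi> s) \<le> \<bar>M\<bar>" if "s \<in> {0..\<tau>}" for \<phi> s
    using M in_K[OF that, of "\<phi> s"] by (force simp: g_def)
  have g_diff: "norm (g \<phi> s - g \<psi> s) \<le> L * dist (\<phi> s) (\<psi> s)" if "s \<in> {0..\<tau>}" for \<phi> \<psi> s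
  proof -
    have "norm (g \<phi> s - g \<psi> s) \<le> L * dist (\<pi> (\<phi> s)) (\<pi> (\<psi> s))"
      using L(2)[OF in_K[OF that, of "\<phi> s"] in_K[OF that, of "\<psi> s"]]
      by (simp add: g_def dist_norm norm_Pair)
    also have "\<dots> \<le> L * dist (\<phi> s) (\<psi> s)"
      by (intro mult_left_mono \<pi> L)
    finally show ?thesis .
  qed
  \<comment> \<open>Clamping the time to [0,\<tau>] extends the integral to a bounded continuous
    function on the whole line.\<close>
  have "\<exists>P::real \<Rightarrow>\<^sub>C (real^'n). \<forall>t. P t = x0 + integral {0..clamp 0 \<tau> t} (g \<phi>)"
    if "continuous_on UNIV \<phi>" for \<phi>
  proof -
    have "continuous_on (cbox 0 \<tau>) (\<lambda>t. x0 + integral {0..t} (g \<phi>))"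
      using \<tau>(1) by (auto intro!: continuous_intros indefinite_integral_continuous_1
          integrable_continuous_real g_cont that)
    from continuous_on_cbox_bcontfunE[OF this] show ?thesis by metis
  qed
  then have "\<forall>\<phi>::real \<Rightarrow>\<^sub>C (real^'n). \<exists>P::real \<Rightarrow>\<^sub>C (real^'n).
      \<forall>t. P t = x0 + integral {0..clamp 0 \<tau> t} (g \<phi>)"
    by simp
  from choice[OF this] obtain P :: "(real \<Rightarrow>\<^sub>C (real^'n)) \<Rightarrow> (real \<Rightarrow>\<^sub>C (real^'n))"
    where P: "\<forall>\<phi> t. P \<phi> t = x0 + integral {0..clamp 0 \<tau> t} (g \<phi>)" by blast
  have clamp: "clamp 0 \<tau> t \<in> {0..\<tau>}" for t
    using clamp_in_interval[of 0 \<tau> t] \<tau>(1) by simp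
  have "dist (P \<phi>) (P \<psi>) \<le> (L * \<tau>) * dist \<phi> \<psi>" for \<phi> \<psi>
  proof (rule dist_bound)
    fix t
    let ?t = "clamp 0 \<tau> t"
    have int: "g (apply_bcontfun \<phi>) integrable_on {0..?t}" for \<phi>
      using clamp[of t] by (intro integrable_continuous_real g_cont) auto
    have "dist (P \<phi> t) (P \<psi> t) = norm (integral {0..?t} (\<lambda>s. g \<phi> s - g \<psi> s))"
      using P by (simp add: dist_norm integral_diff[OF int int])
    also have "\<dots> \<le> (L * dist \<phi> \<psi>) * (?t - 0)"
    proof (rule integral_bound)
      show "continuous_on {0..?t} (\<lambda>s. g \<phi> s - g \<psi> s)"
        using clamp[of t] by (intro continuous_intros g_cont) auto
      fix s assume "s \<in> {0..?t}"
      then show "norm (g \<phi> s - g \<psi> s) \<le> L * dist \<phi> \<psi>"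
        using clamp[of t] by (intro order_trans[OF g_diff] mult_left_mono dist_bounded L) auto
    qed (use clamp[of t] in auto)
    also have "\<dots> \<le> (L * dist \<phi> \<psi>) * \<tau>"
      using clamp[of t] L(1) by (intro mult_left_mono) auto
    finally show "dist (P \<phi> t) (P \<psi> t) \<le> L * \<tau> * dist \<phi> \<psi>"
      by (simp add: ac_simps)
  qed
  then obtain \<phi> where "P \<phi> = \<phi>"
    using banach_fix_type[of "L * \<tau>" P] L(1) \<tau> by auto
  with P have fix_eq: "\<phi> t = x0 + integral {0..t} (g \<phi>)" if "t \<in> {0..\<tau>}" for t
    using that by (metis box_real(2) clamp_cancel_cbox)
  have "norm (\<phi> t - x0) \<le> 1" if "t \<in> {0..\<tau>}" for t
  proof -
    have "norm (integral {0..t} (g \<phi>)) \<le> \<bar>M\<bar> * (t - 0)"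
      by (rule integral_bound) (use that g_bound in \<open>auto intro: g_cont\<close>)
    then have "norm (\<phi> t - x0) \<le> \<bar>M\<bar> * (t - 0)"
      using fix_eq[OF that] by simp
    also have "\<dots> \<le> \<bar>M\<bar> * \<tau>"
      using that by (intro mult_left_mono) auto
    finally show ?thesis using \<tau>(4) by simp
  qed
  \<comment> \<open>The fixed point stays in the ball, where the projection is the identity, so it
    solves the original equation.\<close>
  then have \<pi>_eq: "\<pi> (\<phi> t) = \<phi> t" if "t \<in> {0..\<tau>}" for t
    using that by (auto simp: \<pi>_def dist_norm norm_minus_commute intro!: closest_point_self)
  have "solution f u (ereal \<tau>) \<phi>"
    unfolding solution_def
  proof (intro conjI ballI)
    fix t assume "t \<in> time_dom (ereal \<tau>)"
    then have t: "0 \<le> t" "t \<in> {0..\<tau>}" by (auto simp: time_dom_def)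
    have eq: "g \<phi> s = f (\<phi> s) (u s)" if "s \<in> {0..t}" for s
      using t that by (simp add: g_def \<pi>_eq)
    have "continuous_on {0..t} (\<lambda>s. f (\<phi> s) (u s))"
      by (rule continuous_on_eq[OF g_cont[of \<phi> t] eq]) (use t in auto)
    then show int: "set_integrable lebesgue {0..t} (\<lambda>s. f (\<phi> s) (u s))"
      by (rule absolutely_integrable_continuous_real)
    have "\<phi> t = \<phi> 0 + integral {0..t} (g \<phi>)"
      using fix_eq[of 0] fix_eq[OF t(2)] \<tau>(1) by simp
    also have "integral {0..t} (g \<phi>) = integral {0..t} (\<lambda>s. f (\<phi> s) (u s))"
      by (rule integral_cong) (rule eq)
    also have "\<dots> = (LINT s:{0..t}|lebesgue. f (\<phi> s) (u s))"
      using set_lebesgue_integral_eq_integral(2)[OF int] by simp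
    finally show "\<phi> t = \<phi> 0 + (LINT s:{0..t}|lebesgue. f (\<phi> s) (u s))" .
  qed (use \<tau> in auto)
  moreover have "\<phi> 0 = x0" using fix_eq[of 0] \<tau>(1) by simp
  ultimately show thesis using that \<tau>(1) by blast
qed

text \<open>Each time of the union lies in the domain of one member, and with it the whole interval
  back to 0; the integral equation is inherited from that member.\<close>

lemma solution_union:
  fixes f :: "real^'n \<Rightarrow> real \<Rightarrow> real^'n"
  assumes ne: "\<S> \<noteq> {}" and sol: "\<And>T x. (T, x) \<in> \<S> \<Longrightarrow> solution f u T x"
    and compat: "\<And>T x T' x' t. (T, x) \<in> \<S> \<Longrightarrow> (T', x') \<in> \<S> \<Longrightarrow> t \<in> time_dom T \<Longrightarrow>
      t \<in> time_dom T' \<Longrightarrow> x t = x' t"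
  shows "\<exists>T z. solution f u T z \<and> time_dom T = (\<Union>(T, x)\<in>\<S>. time_dom T) \<and>
    (\<forall>(T, x)\<in>\<S>. \<forall>t\<in>time_dom T. z t = x t)"
proof -
  define T where "T = (SUP p\<in>\<S>. fst p)"
  define z where "z t = (SOME v. \<exists>T x. (T, x) \<in> \<S> \<and> t \<in> time_dom T \<and> v = x t)" for t
  have z: "z t = x t" if "(T, x) \<in> \<S>" "t \<in> time_dom T" for T x t
    unfolding z_def by (rule some_equality) (use that compat in blast)+
  have dom: "time_dom T = (\<Union>(T, x)\<in>\<S>. time_dom T)"
    by (auto simp: time_dom_def T_def less_SUP_iff) force+
  have "solution f u T z"
    unfolding solution_def
  proof (intro conjI ballI)
    obtain T' x' where "(T', x') \<in> \<S>" using ne by auto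
    then have "0 < T'" "T' \<le> T"
      using sol by (force simp: solution_def T_def intro: SUP_upper2)+
    then show "0 < T" by simp
    fix t assume "t \<in> time_dom T"
    then obtain T' x' where x': "(T', x') \<in> \<S>" "t \<in> time_dom T'"
      using dom by auto
    have eq: "z s = x' s" if "s \<in> {0..t}" for s
      using z[OF x'(1)] atLeastAtMost_subset_time_dom[OF x'(2)] that by auto
    have "0 \<le> t" using x' by (simp add: time_dom_def)
    have "set_integrable lebesgue {0..t} (\<lambda>s. f (x' s) (u s))"
      "x' t = x' 0 + (LINT s:{0..t}|lebesgue. f (x' s) (u s))"
      using sol[OF x'(1)] x'(2) by (auto simp: solution_def)
    moreover have "set_integrable lebesgue {0..t} (\<lambda>s. f (x' s) (u s)) \<longleftrightarrow>
        set_integrable lebesgue {0..t} (\<lambda>s. f (z s) (u s))"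
      by (rule set_integrable_cong) (auto simp: eq)
    moreover have "(LINT s:{0..t}|lebesgue. f (x' s) (u s)) = (LINT s:{0..t}|lebesgue. f (z s) (u s))"
      by (rule set_lebesgue_integral_cong) (auto simp: eq)
    ultimately show "set_integrable lebesgue {0..t} (\<lambda>s. f (z s) (u s))"
      "z t = z 0 + (LINT s:{0..t}|lebesgue. f (z s) (u s))"
      using eq[of t] eq[of 0] \<open>0 \<le> t\<close> by simp_all
  qed
  moreover have "\<forall>(T, x)\<in>\<S>. \<forall>t\<in>time_dom T. z t = x t"
    using z by auto
  ultimately show ?thesis using dom by blast
qed

text \<open>Zorn's lemma on the solutions through \<open>x0\<close>, ordered by inclusion of their
  graphs over the time domains; the values of the total functions outside these domains are thereby
  ignored.\<close>

lemma maximal_solution_exists: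
  fixes f :: "real^'n \<Rightarrow> real \<Rightarrow> real^'n"
  assumes f: "C_infinity (\<lambda>(x, u). f x u)" and u: "continuous_on {0..} u"
  obtains T x where "maximal_solution f u T x" "x 0 = x0"
proof -
  define graph where "graph = (\<lambda>(T, x :: real \<Rightarrow> real^'n). (\<lambda>t. (t, x t)) ` time_dom T)"
  define \<S> where "\<S> = {(T, x). solution f u T x \<and> x 0 = x0}"
  have "\<exists>M\<in>graph ` \<S>. \<forall>X\<in>graph ` \<S>. M \<subseteq> X \<longrightarrow> X = M"
  proof (rule subset_Zorn_nonempty)
    obtain \<tau> x where "solution f u (ereal \<tau>) x" "x 0 = x0"
      using local_solution_exists[OF f u] by metis
    then show "graph ` \<S> \<noteq> {}" by (auto simp: \<S>_def)
  next
    fix \<C> assume "\<C> \<noteq> {}" and chain: "subset.chain (graph ` \<S>) \<C>"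
    then obtain \<S>' where \<S>': "\<S>' \<subseteq> \<S>" "\<C> = graph ` \<S>'" "\<S>' \<noteq> {}"
      by (auto simp: subset.chain_def subset_image_iff)
    have graph_iff: "(t, v) \<in> graph (T, x) \<longleftrightarrow> t \<in> time_dom T \<and> v = x t" for t v T x
      by (auto simp: graph_def)
    \<comment> \<open>Agreement at common times comes from comparability of graphs within the
      chain.\<close>
    have compat: "x t = x' t" if "(T, x) \<in> \<S>'" "(T', x') \<in> \<S>'" "t \<in> time_dom T" "t \<in> time_dom T'"
      for T x T' x' t
    proof -
      have "graph (T, x) \<in> \<C>" "graph (T', x') \<in> \<C>"
        unfolding \<S>'(2) using that by simp_all
      then have "graph (T, x) \<subseteq> graph (T', x') \<or> graph (T', x') \<subseteq> graph (T, x)"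
        using chain unfolding subset.chain_def by blast
      moreover have "(t, x t) \<in> graph (T, x)" "(t, x' t) \<in> graph (T', x')"
        using that by (simp_all add: graph_iff)
      ultimately have "(t, x t) \<in> graph (T', x') \<or> (t, x' t) \<in> graph (T, x)"
        by blast
      then show ?thesis
        by (auto simp: graph_iff)
    qed
    have sol: "solution f u T x" if "(T, x) \<in> \<S>'" for T x
      using that \<S>'(1) by (auto simp: \<S>_def)
    have "\<exists>T z. solution f u T z \<and> time_dom T = (\<Union>(T, x)\<in>\<S>'. time_dom T) \<and>
      (\<forall>(T, x)\<in>\<S>'. \<forall>t\<in>time_dom T. z t = x t)"
    proof (rule solution_union[OF \<S>'(3)])
      show "solution f u T x" if "(T, x) \<in> \<S>'" for T x
        using that by (rule sol)
      show "x t = x' t" if "(T, x) \<in> \<S>'" "(T', x') \<in> \<S>'" "t \<in> time_dom T" "t \<in> time_dom T'"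
        for T x T' x' t
        by (rule compat[OF that])
    qed
    then obtain T z where z: "solution f u T z" "time_dom T = (\<Union>(T, x)\<in>\<S>'. time_dom T)"
        "\<forall>(T, x)\<in>\<S>'. \<forall>t\<in>time_dom T. z t = x t"
      by (elim exE conjE)
    have z_eq: "z t = x t" if "(T, x) \<in> \<S>'" "t \<in> time_dom T" for T x t
      using bspec[OF z(3) that(1)] that(2) by simp
    obtain T' x' where x': "(T', x') \<in> \<S>'" using \<S>'(3) by auto
    then have "0 \<in> time_dom T'" "x' 0 = x0"
      using \<S>'(1) by (auto simp: \<S>_def solution_def time_dom_def zero_ereal_def)
    then have "z 0 = x0" using z_eq[OF x'] by simp
    then have "(T, z) \<in> \<S>" using z(1) by (simp add: \<S>_def)
    moreover have "\<Union>\<C> = graph (T, z)"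
      unfolding \<S>'(2) using z(2) z_eq by (force simp: graph_def)
    ultimately show "\<Union>\<C> \<in> graph ` \<S>" by blast
  qed
  then obtain T x where x: "solution f u T x" "x 0 = x0"
    and max: "\<And>T' z. solution f u T' z \<Longrightarrow> z 0 = x0 \<Longrightarrow> graph (T, x) \<subseteq> graph (T', z) \<Longrightarrow>
      graph (T', z) = graph (T, x)"
    by (auto simp: \<S>_def)
  have "maximal_solution f u T x"
    unfolding maximal_solution_def
  proof (intro conjI notI x(1))
    assume "\<exists>T' z. T < T' \<and> solution f u T' z \<and> (\<forall>t\<in>time_dom T. z t = x t)"
    then obtain T' z where z: "T < T'" "solution f u T' z" "\<And>t. t \<in> time_dom T \<Longrightarrow> z t = x t"
      by blast
    have "0 < T" using x(1) by (simp add: solution_def)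
    then have "z 0 = x0" using z(3)[of 0] x(2) by (simp add: time_dom_def zero_ereal_def)
    moreover have "time_dom T \<subseteq> time_dom T'" using z(1) by (auto simp: time_dom_def)
    ultimately have "graph (T', z) = graph (T, x)"
      using z by (intro max) (force simp: graph_def)+
    then have "time_dom T' = time_dom T"
      by (auto simp: graph_def set_eq_iff image_iff)
    \<comment> \<open>\<open>T\<close> is finite, being below \<open>T'\<close>, and as a time it
      belongs to the domain of \<open>T'\<close> but not to the right-open domain of
      \<open>T\<close>.\<close>
    moreover obtain t where "T = ereal t" "0 < t"
      using \<open>0 < T\<close> z(1) by (cases T) auto
    then have "t \<in> time_dom T'" "t \<notin> time_dom T"
      using z(1) by (auto simp: time_dom_def)
    ultimately show False by simp
  qed
  then show thesis using that x(2) by blast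
qed

section \<open>The stability estimate at the initial time\<close>

text \<open>With factorial normalisation, differentiation shifts the coefficients.
  \<open>V N = 0\<close> makes the top summand on the right vanish, so both sums keep the range i <
  N.\<close>

lemma has_vector_derivative_taylor_sum:
  fixes V :: "nat \<Rightarrow> real"
  assumes "V N = 0"
  shows "((\<lambda>t. \<Sum>i<N. V i * t ^ i / fact i) has_vector_derivative (\<Sum>i<N. V (Suc i) * t ^ i / fact i)) (at t within I)"
proof (cases N)
  case (Suc M)
  have "((\<lambda>t. V i * t ^ i / fact i) has_real_derivative (case i of 0 \<Rightarrow> 0 | Suc l \<Rightarrow> V i * t ^ l / fact l)) (at t within I)" for i
  proof (cases i)
    case (Suc l)
    have "((\<lambda>t. V i / fact i * t ^ i) has_real_derivative V i / fact i * (real i * t ^ (i - Suc 0))) (at t within I)"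
      by (intro DERIV_cmult DERIV_pow)
    moreover have "V i / fact i * (real i * t ^ (i - Suc 0)) = V i * t ^ l / fact l"
      unfolding Suc fact_Suc by (simp add: divide_simps del: of_nat_Suc)
    ultimately show ?thesis by (simp add: Suc)
  qed simp
  then have "((\<lambda>t. \<Sum>i<N. V i * t ^ i / fact i) has_real_derivative
      (\<Sum>i<N. case i of 0 \<Rightarrow> 0 | Suc l \<Rightarrow> V i * t ^ l / fact l)) (at t within I)"
    by (intro DERIV_sum)
  also have "(\<Sum>i<N. case i of 0 \<Rightarrow> 0 | Suc l \<Rightarrow> V i * t ^ l / fact l) = (\<Sum>i<N. V (Suc i) * t ^ i / fact i)"
    using assms unfolding Suc by (subst sum.lessThan_Suc_shift) simp
  finally show ?thesis
    by (simp add: has_real_derivative_iff_has_vector_derivative)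
qed simp

lemma input_with_prescribed_derivatives:
  fixes U :: "nat \<Rightarrow> real"
  obtains u where "C_sig {0..} m u" "\<And>j. j \<le> m \<Longrightarrow> sig_deriv {0..} j u 0 = U j"
proof
  \<comment> \<open>The input is a Taylor polynomial. Padding its coefficients with zeros lets
    \<open>P j\<close>, the j-th derivative, have the same form with shifted coefficients for every
    \<open>j\<close>.\<close>
  define V where "V i = (if i \<le> m then U i else 0)" for i
  define P where "P j t = (\<Sum>i<Suc m. V (i + j) * t ^ i / fact i)" for j and t :: real
  have P: "(P j has_vector_derivative P (Suc j) t) (at t within {0..})" for j t
    unfolding P_def using has_vector_derivative_taylor_sum[of "\<lambda>i. V (i + j)" "Suc m"]
    by (simp add: V_def del: sum.lessThan_Suc)
  note sig = sig_deriv_Suc[where T = \<infinity>, unfolded time_dom_PInf, OF _ _ P]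
  have eq: "sig_deriv {0..} j (P 0) t = P j t" if "0 \<le> t" for j t
    using that by (induction j arbitrary: t) (auto intro: sig(1))
  show "C_sig {0..} m (P 0)"
    unfolding C_sig_def
  proof (intro conjI allI impI ballI)
    show "sig_deriv {0..} j (P 0) differentiable (at t within {0..})" if "t \<in> {0..}" for j t
      using that eq by (intro sig(2)) auto
    have "continuous_on {0..} (P m)"
      unfolding P_def by (intro continuous_intros) simp
    then show "continuous_on {0..} (sig_deriv {0..} m (P 0))"
      by (rule continuous_on_eq) (simp add: eq)
  qed
  show "sig_deriv {0..} j (P 0) 0 = U j" if "j \<le> m" for j
    using that by (simp add: eq P_def V_def sum.lessThan_Suc_shift del: sum.lessThan_Suc)
qed

lemma output_input_stable_initial_bound:
  fixes f :: "real^'n \<Rightarrow> real \<Rightarrow> real^'n"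
  assumes f: "C_infinity (\<lambda>(x, u). f x u)" and h: "C_infinity h"
    and ois: "output_input_stable f h N"
  obtains \<alpha> \<gamma> where "class_K \<alpha>" "class_K_inf \<gamma>"
    "\<And>x U. norm (U 0, x) \<le> \<alpha> (norm x) + \<gamma> (L2_set (\<lambda>j. H f h j x U) {..N})"
proof -
  from ois obtain m where N: "N = Suc m"
    unfolding output_input_stable_def using gr0_implies_Suc by blast
  from ois obtain \<beta> \<gamma> where \<beta>: "class_KL \<beta>" and \<gamma>: "class_K_inf \<gamma>"
    and bound: "\<And>u T x t. C_sig {0..} m u \<Longrightarrow> maximal_solution f u T x \<Longrightarrow> t \<in> time_dom T \<Longrightarrow>
      norm (u t, x t) \<le> \<beta> (norm (x 0)) t + \<gamma> (ess_sup_on 0 t (jet_norm (time_dom T) N (\<lambda>s. h (x s))))"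
    unfolding output_input_stable_def N diff_Suc_1 by blast
  have "norm (U 0, x0) \<le> \<beta> (norm x0) 0 + \<gamma> (L2_set (\<lambda>j. H f h j x0 U) {..N})" for x0 U
  proof -
    obtain u where u: "C_sig {0..} m u" "\<And>j. j \<le> m \<Longrightarrow> sig_deriv {0..} j u 0 = U j"
      using input_with_prescribed_derivatives by blast
    obtain T x where x: "maximal_solution f u T x" "x 0 = x0"
      using maximal_solution_exists[OF f C_sig_continuous[OF u(1), of 0, simplified]] by blast
    then have sol: "solution f u T x" and 0: "0 \<in> time_dom T"
      by (auto simp: maximal_solution_def solution_def time_dom_def zero_ereal_def)
    have "sig_deriv (time_dom T) j (\<lambda>s. h (x s)) 0 = H f h j x0 U" if "j \<le> N" for j
    proof -
      \<comment> \<open>H_j with j <= N reads at most u_0, ..., u_(N-1), exactly the derivatives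
        that were prescribed.\<close>
      have "H f h j x0 (\<lambda>i. sig_deriv {0..} i u 0) = H f h j x0 U"
        using that u(2) by (intro H_cong) (simp add: N)
      then show ?thesis
        using sig_deriv_output[OF f h sol u(1) _ 0, of j] that x(2) by (simp add: N)
    qed
    then have "jet_norm (time_dom T) N (\<lambda>s. h (x s)) 0 = L2_set (\<lambda>j. H f h j x0 U) {..N}"
      unfolding jet_norm_def by (intro L2_set_cong) auto
    moreover have "u 0 = U 0" using u(2)[of 0] by simp
    \<comment> \<open>At time 0 \<open>ess_sup_on\<close> takes the value of the jet norm at 0, and
      \<beta>(., 0) provides the class K function.\<close>
    ultimately show ?thesis
      using bound[OF u(1) x(1) 0] x(2) by (simp add: ess_sup_on_def)
  qed
  moreover have "class_K (\<lambda>s. \<beta> s 0)" using \<beta> by (simp add: class_KL_def)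
  ultimately show thesis using \<gamma> that by blast
qed

section \<open>The functions H above the relative degree\<close>

text \<open>The partial derivatives in the input entries vanish and the Lie derivative along f
  remains. Fixing \<open>v\<close> makes the linear map independent of \<open>u\<close>, which then
  enters only through \<open>f x (u 0)\<close>.\<close>

lemma H_Suc_of_input_independent:
  assumes "\<And>x u v. H f h k x u = H f h k x v"
  shows "H f h (Suc k) x u = frechet_derivative (\<lambda>z. H f h k z v) (at x) (f x (u 0))"
proof -
  have "(\<lambda>z. H f h k z u) = (\<lambda>z. H f h k z v)"
    using assms by blast
  moreover have "(\<lambda>s. H f h k x (u(j := s))) = (\<lambda>s. H f h k x u)" for j
    using assms by blast
  ultimately show ?thesis by simp
qed

lemma H_relative_degree_cong:
  assumes "0 < r" "\<And>k x u v. k < r \<Longrightarrow> H f h k x u = H f h k x v" "u 0 = v 0"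
  shows "H f h r x u = H f h r x v"
proof -
  obtain k where r: "r = Suc k" using assms(1) gr0_implies_Suc by blast
  have "H f h k x u = H f h k x v" for x u v
    using assms(2) r by blast
  from H_Suc_of_input_independent[of f h k, OF this] show ?thesis
    unfolding r using assms(3) by metis
qed

text \<open>The partial derivative of H_r in u_0. At the relative degree H_r sees only u_0, so a
  constant sequence can stand for every sequence that starts with \<open>a\<close>.\<close>

definition dH :: "(real^'n \<Rightarrow> real \<Rightarrow> real^'n) \<Rightarrow> (real^'n \<Rightarrow> real) \<Rightarrow> nat \<Rightarrow> real^'n \<Rightarrow> real \<Rightarrow> real" where
  "dH f h r x = deriv (\<lambda>a. H f h r x (\<lambda>_. a))"

text \<open>In the recursion u_(j+1) occurs only as the factor of the partial derivative in u_j,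
  here \<open>D\<close>; everything else goes into \<open>A\<close>. An abstract \<open>D\<close>
  lets the same step serve inside the induction and after it.\<close>

lemma H_affine_in_last_input_step:
  assumes "0 < r"
    and cong: "\<forall>x u v. (\<forall>i\<le>j. u i = v i) \<longrightarrow> H f h (r + j) x u = H f h (r + j) x v"
    and d: "\<forall>x u. deriv (\<lambda>s. H f h (r + j) x (u(j := s))) (u j) = D x (u 0)"
  shows "\<exists>A. (\<forall>x u v. (\<forall>i\<le>j. u i = v i) \<longrightarrow> A x u = A x v) \<and>
    (\<forall>x u. H f h (Suc (r + j)) x u = A x u + D x (u 0) * u (Suc j))"
proof (intro exI conjI allI impI)
  let ?d = "\<lambda>x u i. deriv (\<lambda>s. H f h (r + j) x (u(i := s))) (u i)"
  let ?A = "\<lambda>x u. frechet_derivative (\<lambda>z. H f h (r + j) z u) (at x) (f x (u 0)) +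
    (\<Sum>i<j. ?d x u i * u (Suc i))"
  show "?A x u = ?A x v" if eq: "\<forall>i\<le>j. u i = v i" for x and u v :: "nat \<Rightarrow> real"
  proof -
    have "(\<lambda>z. H f h (r + j) z u) = (\<lambda>z. H f h (r + j) z v)"
      by (intro ext cong[rule_format]) (simp add: eq)
    moreover have "(\<lambda>s. H f h (r + j) x (u(i := s))) = (\<lambda>s. H f h (r + j) x (v(i := s)))" for i
      by (intro ext cong[rule_format]) (simp add: eq)
    ultimately show ?thesis by (simp add: eq)
  qed
  fix x and u :: "nat \<Rightarrow> real"
  have "?d x u i = 0" if "j < i" for i
  proof -
    have "(\<lambda>s. H f h (r + j) x (u(i := s))) = (\<lambda>s. H f h (r + j) x u)"
      using that by (intro ext cong[rule_format]) simp
    then show ?thesis by simp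
  qed
  \<comment> \<open>\<open>0 < r\<close> puts the index j, whose term carries u_(j+1), into the
    range of the sum.\<close>
  then have "(\<Sum>i<r + j. ?d x u i * u (Suc i)) = (\<Sum>i<Suc j. ?d x u i * u (Suc i))"
    using \<open>0 < r\<close> by (intro sum.mono_neutral_right) auto
  then show "H f h (Suc (r + j)) x u = ?A x u + D x (u 0) * u (Suc j)"
    by (simp add: d)
qed

text \<open>The slope passes unchanged from each order to the next, because the remainder
  \<open>A\<close> does not see the newest input entry.\<close>

lemma H_affine_in_last_input:
  assumes "0 < r" and indep: "\<And>k x u v. k < r \<Longrightarrow> H f h k x u = H f h k x v"
  shows "\<exists>A. (\<forall>x u v. (\<forall>i\<le>j. u i = v i) \<longrightarrow> A x u = A x v) \<and>
    (\<forall>x u. H f h (Suc (r + j)) x u = A x u + dH f h r x (u 0) * u (Suc j))"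
proof -
  have "(\<forall>x u v. (\<forall>i\<le>j. u i = v i) \<longrightarrow> H f h (r + j) x u = H f h (r + j) x v) \<and>
      (\<forall>x u. deriv (\<lambda>s. H f h (r + j) x (u(j := s))) (u j) = dH f h r x (u 0))"
  proof (induction j)
    case 0
    have 1: "(\<lambda>s. H f h r x (u(0 := s))) = (\<lambda>s. H f h r x (\<lambda>_. s))" for x u
      by (rule ext, rule H_relative_degree_cong[OF assms(1)], erule indep, simp)
    have 2: "H f h r x u = H f h r x v" if "u 0 = v 0" for x u v
      by (rule H_relative_degree_cong[OF assms(1)], erule indep, rule that)
    show ?case
    proof (intro conjI allI impI)
      show "H f h (r + 0) x u = H f h (r + 0) x v" if "\<forall>i\<le>0. u i = v i" for x u v
        using that 2[of u v x] by simp
      show "deriv (\<lambda>s. H f h (r + 0) x (u(0 := s))) (u 0) = dH f h r x (u 0)" for x u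
        by (simp add: 1 dH_def)
    qed
  next
    case (Suc j)
    obtain A where A: "\<And>x u v. \<forall>i\<le>j. u i = v i \<Longrightarrow> A x u = A x v"
      "\<And>x u. H f h (Suc (r + j)) x u = A x u + dH f h r x (u 0) * u (Suc j)"
      using H_affine_in_last_input_step[OF \<open>0 < r\<close> Suc[THEN conjunct1] Suc[THEN conjunct2]] by blast
    have "H f h (r + Suc j) x u = H f h (r + Suc j) x v" if "\<forall>i\<le>Suc j. u i = v i" for x u v
      using A(1)[of u v x] that by (simp add: A(2) del: H.simps)
    moreover have "deriv (\<lambda>s. H f h (r + Suc j) x (u(Suc j := s))) (u (Suc j)) = dH f h r x (u 0)" for x u
    proof -
      have "(\<lambda>s. H f h (r + Suc j) x (u(Suc j := s))) = (\<lambda>s. A x u + dH f h r x (u 0) * s)"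
        using A(1)[of "u(Suc j := s)" u x for s] by (auto simp: A(2) fun_eq_iff simp del: H.simps)
      moreover have "((\<lambda>s. A x u + dH f h r x (u 0) * s) has_real_derivative dH f h r x (u 0)) (at (u (Suc j)))"
        by (auto intro!: derivative_eq_intros)
      ultimately show ?thesis by (simp only: DERIV_imp_deriv)
    qed
    ultimately show ?case by blast
  qed
  then show ?thesis
    by (intro H_affine_in_last_input_step[OF \<open>0 < r\<close>]) (rule conjunct1 conjunct2, assumption)+
qed

lemma inputs_annihilating_H:
  assumes "0 < r" and indep: "\<And>k x u v. k < r \<Longrightarrow> H f h k x u = H f h k x v"
    and d: "dH f h r x a \<noteq> 0"
  shows "\<exists>u. u 0 = a \<and> (\<forall>j<m. H f h (Suc (r + j)) x u = 0)"
proof (induction m)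
  case 0
  show ?case by (rule exI[of _ "\<lambda>_. a"]) simp
next
  case (Suc m)
  then obtain u where u: "u 0 = a" "\<And>j. j < m \<Longrightarrow> H f h (Suc (r + j)) x u = 0" by blast
  have affine: "\<exists>A. (\<forall>x u v. (\<forall>i\<le>j. u i = v i) \<longrightarrow> A x u = A x v) \<and>
      (\<forall>x u. H f h (Suc (r + j)) x u = A x u + dH f h r x (u 0) * u (Suc j))" for j
    by (rule H_affine_in_last_input[OF \<open>0 < r\<close>]) (rule indep)
  obtain A where A: "\<And>x u v. \<forall>i\<le>m. u i = v i \<Longrightarrow> A x u = A x v"
    "\<And>x u. H f h (Suc (r + m)) x u = A x u + dH f h r x (u 0) * u (Suc m)"
    using affine[of m] by blast
  \<comment> \<open>The affine equation of order \<open>m\<close> is solved for its newest entry.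
    The earlier equations read only entries up to index \<open>m\<close> and stay satisfied.\<close>
  define v where "v = u(Suc m := - A x u / dH f h r x a)"
  have "H f h (Suc (r + j)) x v = 0" if "j < m" for j
  proof -
    obtain A' where A': "\<And>x u v. \<forall>i\<le>j. u i = v i \<Longrightarrow> A' x u = A' x v"
      "\<And>x u. H f h (Suc (r + j)) x u = A' x u + dH f h r x (u 0) * u (Suc j)"
      using affine[of j] by blast
    have "A' x v = A' x u" using that by (intro A'(1)) (simp add: v_def)
    then show ?thesis using u(2)[OF that] that by (simp add: A'(2) v_def del: H.simps)
  qed
  moreover have "H f h (Suc (r + m)) x v = 0"
  proof -
    have "A x v = A x u" by (intro A(1)) (simp add: v_def)
    then show ?thesis using d u(1) by (simp add: A(2) v_def del: H.simps)
  qed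
  moreover have "v 0 = a" using u(1) by (simp add: v_def)
  ultimately show ?case
    by (intro exI[of _ v]) (auto simp: less_Suc_eq simp del: H.simps)
qed

text \<open>In the recursion every total derivative is applied to f(0,0) = 0 or multiplied by a zero
  input entry.\<close>

lemma H_equilibrium:
  fixes f :: "real^'n \<Rightarrow> real \<Rightarrow> real^'n"
  assumes f: "C_infinity (\<lambda>(x, u). f x u)" and h: "C_infinity h" and "f 0 0 = 0" "h 0 = 0"
  shows "H f h k 0 (\<lambda>_. 0) = 0"
proof (cases k)
  case (Suc l)
  have "linear (frechet_derivative (Hs f h l) (at p))" for p
    using C_infinity_has_derivative[OF C_infinity_Hs[OF f h]] has_derivative_linear by blast
  then have "frechet_derivative (Hs f h l) (at p) 0 = 0" for p
    by (rule linear_0)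
  then show ?thesis
    unfolding Suc H_Suc[OF C_infinity_Hs[OF f h]] by (simp add: assms zero_prod_def)
qed (simp add: assms)

lemma continuous_on_H_const:
  fixes f :: "real^'n \<Rightarrow> real \<Rightarrow> real^'n"
  assumes "C_infinity (\<lambda>(x, u). f x u)" "C_infinity h"
  shows "continuous_on UNIV (\<lambda>p. H f h k (fst p) (\<lambda>_. snd p))"
  unfolding H_eq_Hs trunc_def
  by (intro continuous_on_compose2[OF C_infinity_imp_continuous[OF C_infinity_Hs[OF assms]]]
      continuous_intros) auto

section \<open>Real analytic functions\<close>

lemma real_analytic_linear_compose:
  assumes g: "real_analytic g" and L: "bounded_linear L"
  shows "real_analytic (\<lambda>s. L (g s))"
  unfolding real_analytic_def
proof
  fix a
  obtain c \<delta> where "\<delta> > 0" and c: "\<And>s. \<bar>s - a\<bar> < \<delta> \<Longrightarrow> (\<lambda>m. (s - a) ^ m *\<^sub>R c m) sums g s"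
    using g unfolding real_analytic_def by metis
  have "(\<lambda>m. (s - a) ^ m *\<^sub>R L (c m)) sums L (g s)" if "\<bar>s - a\<bar> < \<delta>" for s
    using bounded_linear.sums[OF L c[OF that]] by (simp add: linear_simps[OF L])
  with \<open>\<delta> > 0\<close> show "\<exists>c \<delta>. \<delta> > 0 \<and> (\<forall>s. \<bar>s - a\<bar> < \<delta> \<longrightarrow> (\<lambda>m. (s - a) ^ m *\<^sub>R c m) sums L (g s))"
    by (intro exI[of _ "\<lambda>m. L (c m)"] exI[of _ \<delta>]) auto
qed

text \<open>The interior \<open>W\<close> of the level set is open and nonempty. At a limit point of
  \<open>W\<close> the zero of g - k is not isolated, so the power series is constant there; hence
  \<open>W\<close> is closed too.\<close>

lemma real_analytic_locally_constant:
  fixes g :: "real \<Rightarrow> real"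
  assumes g: "real_analytic g" "continuous_on UNIV g" and V: "open V" "V \<noteq> {}" "\<And>s. s \<in> V \<Longrightarrow> g s = k"
  shows "g s = k"
proof -
  define W where "W = interior {s. g s = k}"
  have "V \<subseteq> W" unfolding W_def using V by (intro interior_maximal) auto
  with V(2) have "W \<noteq> {}" by auto
  moreover have "open W" by (simp add: W_def)
  moreover have "closed W"
    unfolding closed_limpt
  proof (intro allI impI)
    fix a assume a: "a islimpt W"
    obtain c \<delta> where "\<delta> > 0" and c: "\<And>s. \<bar>s - a\<bar> < \<delta> \<Longrightarrow> (\<lambda>m. (s - a) ^ m *\<^sub>R c m) sums g s"
      using g(1) unfolding real_analytic_def by metis
    \<comment> \<open>The series of g - c_0, which vanishes at \<open>a\<close>; isolation of its
      zeros is triggered by a nonzero coefficient of positive index.\<close>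
    define c' where "c' = c(0 := 0)"
    have c': "(\<lambda>m. c' m * (s - a) ^ m) sums (g s - c 0)" if "norm (s - a) < \<delta>" for s
    proof -
      have "(\<lambda>m. (s - a) ^ m *\<^sub>R c m - (if m = 0 then c 0 else 0)) sums (g s - c 0)"
        using that by (intro sums_diff c sums_single[of 0 "\<lambda>_. c 0", simplified]) simp
      also have "(\<lambda>m. (s - a) ^ m *\<^sub>R c m - (if m = 0 then c 0 else 0)) = (\<lambda>m. c' m * (s - a) ^ m)"
        by (auto simp: c'_def fun_eq_iff)
      finally show ?thesis .
    qed
    have ga: "g a - c 0 = 0"
    proof -
      have "(\<lambda>m. c' m * (a - a) ^ m) = (\<lambda>m. 0)" by (auto simp: c'_def fun_eq_iff power_0_left)
      then have "(\<lambda>m. 0) sums (g a - c 0)" using c'[of a] \<open>\<delta> > 0\<close> by simp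
      then show ?thesis using sums_unique2 sums_zero by blast
    qed
    have sub: "W \<subseteq> {s. g s = k}" by (simp add: W_def interior_subset)
    have "closed {s. g s = k}"
      using g(2) by (intro closed_Collect_eq) auto
    then have gk: "g a = k"
      using islimpt_subset[OF a sub] by (auto simp: closed_limpt)
    have "c' m = 0" for m
    proof (rule ccontr)
      assume m: "c' m \<noteq> 0"
      then have "m > 0" by (metis c'_def fun_upd_same gr0I)
      obtain \<epsilon> where \<epsilon>: "\<epsilon> > 0" "\<And>z. z \<in> cball a \<epsilon> - {a} \<Longrightarrow> g z - c 0 \<noteq> 0"
        using powser_0_nonzero[of \<delta> a c' "\<lambda>s. g s - c 0", OF \<open>\<delta> > 0\<close> c' ga m \<open>m > 0\<close>] by blast
      obtain w where w: "w \<in> W" "w \<noteq> a" "dist w a < \<epsilon>"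
        using a \<epsilon>(1) unfolding islimpt_approachable by blast
      then have "g w = k" using sub by auto
      with \<epsilon>(2)[of w] w ga gk show False by (simp add: dist_commute)
    qed
    then have "g s = k" if "norm (s - a) < \<delta>" for s
      using sums_unique2[OF c'[OF that], of 0] ga gk by simp
    then have "ball a \<delta> \<subseteq> {s. g s = k}"
      by (auto simp: dist_norm norm_minus_commute)
    then have "ball a \<delta> \<subseteq> W"
      unfolding W_def by (intro interior_maximal) auto
    with \<open>\<delta> > 0\<close> show "a \<in> W" by auto
  qed
  ultimately have "W = UNIV" using clopen by blast
  then show ?thesis using interior_subset[of "{s. g s = k}"] by (auto simp: W_def)
qed

section \<open>Class K majorants\<close>

text \<open>The maximum \<open>M\<close> of \<open>g\<close> over balls is continuous and
  nondecreasing; adding the identity makes it strictly increasing and at least the identity.\<close>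

lemma class_K_majorant:
  fixes g :: "'a::euclidean_space \<Rightarrow> real"
  assumes g: "continuous_on UNIV g" and "g 0 = 0"
  obtains \<omega> where "class_K \<omega>" "\<And>s. 0 \<le> s \<Longrightarrow> s \<le> \<omega> s" "\<And>x. g x \<le> \<omega> (norm x)"
proof -
  define M where "M s = (SUP x\<in>cball 0 s. g x)" for s
  have bdd: "bdd_above (g ` cball 0 s)" for s
    by (intro bounded_imp_bdd_above compact_imp_bounded compact_continuous_image
        continuous_on_subset[OF g]) auto
  have le_M: "g x \<le> M s" if "norm x \<le> s" for x s
    unfolding M_def using that by (intro cSUP_upper bdd) auto
  have M_le: "M s \<le> C" if "0 \<le> s" "\<And>x. norm x \<le> s \<Longrightarrow> g x \<le> C" for s C
    unfolding M_def using that by (intro cSUP_least) auto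
  have mono: "M s \<le> M t" if "0 \<le> s" "s \<le> t" for s t
    using that by (intro M_le le_M) auto
  have "M 0 = 0"
    using le_M[of 0 0] M_le[of 0 0] \<open>g 0 = 0\<close> by auto
  have cont: "continuous_on {0..} M"
    unfolding continuous_on_iff
  proof (intro ballI allI impI)
    fix s0 e :: real assume "s0 \<in> {0..}" "0 < e"
    then have "0 \<le> s0" by simp
    have "uniformly_continuous_on (cball 0 (s0 + 1)) g"
      by (intro compact_uniformly_continuous continuous_on_subset[OF g]) auto
    then obtain d where d: "0 < d" "\<And>x y. x \<in> cball 0 (s0 + 1) \<Longrightarrow> y \<in> cball 0 (s0 + 1) \<Longrightarrow>
        dist y x < d \<Longrightarrow> dist (g y) (g x) < e / 2"
      using \<open>0 < e\<close> unfolding uniformly_continuous_on_def by (metis half_gt_zero)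
    have step: "M t \<le> M s + e / 2" if st: "0 \<le> s" "s \<le> t" "t \<le> s0 + 1" "t - s < d" for s t
    proof (rule M_le)
      fix x :: 'a assume x: "norm x \<le> t"
      show "g x \<le> M s + e / 2"
      proof (cases "norm x \<le> s")
        case True
        then show ?thesis using le_M[of x s] \<open>0 < e\<close> by simp
      next
        case False
        \<comment> \<open>The radial projection of x onto the sphere of radius s moves x by at most
          t - s < d, so uniform continuity compares the two values.\<close>
        define y where "y = (s / norm x) *\<^sub>R x"
        have "norm y = s" using False st(1) by (auto simp: y_def)
        moreover have "norm (x - y) = norm x - s"
        proof -
          have "x - y = (1 - s / norm x) *\<^sub>R x"
            by (simp add: y_def scaleR_diff_left)
          moreover have "0 \<le> 1 - s / norm x" "norm x \<noteq> 0"
            using False st(1) by (auto simp: divide_le_eq)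
          ultimately show ?thesis
            by (simp add: left_diff_distrib)
        qed
        ultimately have "dist (g x) (g y) < e / 2"
          using x st by (intro d(2)) (auto simp: dist_norm)
        moreover have "g y \<le> M s"
          using \<open>norm y = s\<close> by (intro le_M) simp
        ultimately show ?thesis
          unfolding dist_real_def by linarith
      qed
    qed (use st in simp)
    show "\<exists>d>0. \<forall>s\<in>{0..}. dist s s0 < d \<longrightarrow> dist (M s) (M s0) < e"
    proof (intro exI[of _ "min d 1"] conjI ballI impI)
      fix s assume "s \<in> {0..}" and s: "dist s s0 < min d 1"
      then have "0 \<le> s" by simp
      show "dist (M s) (M s0) < e"
      proof (cases "s \<le> s0")
        case True
        then have "M s \<le> M s0" "M s0 \<le> M s + e / 2"
          using s \<open>0 \<le> s\<close> by (auto intro!: mono step simp: dist_real_def)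
        then show ?thesis using \<open>0 < e\<close> by (simp add: dist_real_def)
      next
        case False
        then have "M s0 \<le> M s" "M s \<le> M s0 + e / 2"
          using s \<open>0 \<le> s0\<close> by (auto intro!: mono step simp: dist_real_def)
        then show ?thesis using \<open>0 < e\<close> by (simp add: dist_real_def)
      qed
    qed (use d in simp)
  qed
  show thesis
  proof (rule that[of "\<lambda>s. M s + s"])
    show "class_K (\<lambda>s. M s + s)"
      by (intro class_KI continuous_intros cont add_le_less_mono mono) (auto simp: \<open>M 0 = 0\<close>)
    show "s \<le> M s + s" if "0 \<le> s" for s
      using mono[of 0 s] that \<open>M 0 = 0\<close> by simp
    show "g x \<le> M (norm x) + norm x" for x
      using le_M[of x "norm x"] norm_ge_zero[of x] by linarith
  qed
qed

section \<open>Output-input stability implies a relative degree\<close>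

lemma bound_at_relative_degree:
  fixes f :: "real^'n \<Rightarrow> real \<Rightarrow> real^'n"
  assumes f: "C_infinity (\<lambda>(x, u). f x u)" and h: "C_infinity h"
    and analytic: "\<And>x. real_analytic (f x)"
    and \<alpha>: "class_K \<alpha>" and \<gamma>: "class_K_inf \<gamma>"
    and bound: "\<And>x U. norm (U 0, x) \<le> \<alpha> (norm x) + \<gamma> (L2_set (\<lambda>j. H f h j x U) {..N})"
    and r: "0 < r" "r \<le> N" and indep: "\<And>k x u v. k < r \<Longrightarrow> H f h k x u = H f h k x v"
    and dep: "H f h r x0 u0 \<noteq> H f h r x0 v0"
  shows "norm (a, x) \<le> \<alpha> (norm x) + \<gamma> (L2_set (\<lambda>j. H f h j x (\<lambda>_. a)) {..r})"
proof -
  define G where "G p = L2_set (\<lambda>j. H f h j (fst p) (\<lambda>_. snd p)) {..r}" for p :: "(real^'n) \<times> real"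
  define B where "B p = \<alpha> (norm (fst p)) + \<gamma> (G p)" for p
  define K where "K x a = H f h r x (\<lambda>_. a)" for x a
  have cong: "H f h r x u = K x (u 0)" for x u
    unfolding K_def by (rule H_relative_degree_cong[OF r(1)], erule indep, simp)
  have K_cont: "continuous_on UNIV (\<lambda>p. K (fst p) (snd p))"
    unfolding K_def by (rule continuous_on_H_const[OF f h])
  have K_cont1: "continuous_on UNIV (\<lambda>x. K x a)" for a
    using continuous_on_compose2[OF K_cont, of UNIV "\<lambda>x. (x, a)"]
    by (simp add: continuous_on_Pair)
  have K_cont2: "continuous_on UNIV (K x)" for x
    using continuous_on_compose2[OF K_cont, of UNIV "\<lambda>a. (x, a)"]
    by (simp add: continuous_on_Pair)
  have G_cont: "continuous_on UNIV G"
    unfolding G_def L2_set_def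
    by (intro continuous_intros continuous_on_H_const[OF f h])
  have B_cont: "continuous_on UNIV B"
    unfolding B_def
    by (intro continuous_on_add continuous_on_compose2[OF class_K_continuous[OF \<alpha>]]
        continuous_on_compose2[OF class_K_continuous[OF class_K_inf_D[OF \<gamma>]]] G_cont continuous_intros)
      (auto simp: G_def)
  have "closed {p. norm (snd p, fst p) \<le> B p}"
    by (intro closed_Collect_le B_cont continuous_intros)
  moreover define C where "C = {p. norm (snd p, fst p) \<le> B p}"
  ultimately have C: "closed C" by simp
  have slice: "closed {a. (x, a) \<in> C}" "closed {x. (x, a) \<in> C}" for x a
    using continuous_closed_vimage[OF C, of "\<lambda>a. (x, a)"] continuous_closed_vimage[OF C, of "\<lambda>x. (x, a)"]
    by (auto simp: vimage_def intro!: continuous_intros)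

  text \<open>Where the derivative is nonzero, the higher functions \<open>H\<close> can be made to vanish
    by the choice of the derivatives of the input.\<close>
  have base: "(x, a) \<in> C" if d: "dH f h r x a \<noteq> 0" for x a
  proof -
    obtain u where u: "u 0 = a" "\<And>j. j < N \<Longrightarrow> H f h (Suc (r + j)) x u = 0"
      using inputs_annihilating_H[of r f h x a N, OF r(1) _ d] indep by blast
    have "H f h j x u = 0" if "j \<in> {..N} - {..r}" for j
    proof -
      have "Suc (r + (j - Suc r)) = j" "j - Suc r < N" using that r by auto
      then show ?thesis using u(2)[of "j - Suc r"] by metis
    qed
    then have "(\<Sum>j\<le>N. (H f h j x u)\<^sup>2) = (\<Sum>j\<le>r. (H f h j x u)\<^sup>2)"
      using r by (intro sum.mono_neutral_right) auto
    also have "\<dots> = (\<Sum>j\<le>r. (H f h j x (\<lambda>_. a))\<^sup>2)"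
    proof (rule sum.cong[OF refl])
      fix j assume "j \<in> {..r}"
      then have "H f h j x u = H f h j x (\<lambda>_. a)"
        using indep[of j x u "\<lambda>_. a"] cong[of x u] u(1) by (cases "j = r") (auto simp: K_def)
      then show "(H f h j x u)\<^sup>2 = (H f h j x (\<lambda>_. a))\<^sup>2" by simp
    qed
    finally show ?thesis
      using bound[of u x] u(1) by (simp add: C_def B_def G_def L2_set_def)
  qed

  obtain k where k: "r = Suc k" using r(1) gr0_implies_Suc by blast
  \<comment> \<open>As H_(r-1) ignores the input, \<open>K x\<close> is a fixed linear functional
    applied to f(x, .).\<close>
  have K_analytic: "real_analytic (K x)" for x
  proof -
    let ?D = "frechet_derivative (\<lambda>z. H f h k z (\<lambda>_. 0)) (at x)"
    have "((\<lambda>z. Hs f h k (z, trunc k (\<lambda>_. 0))) has_derivative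
        (\<lambda>v. frechet_derivative (Hs f h k) (at (x, trunc k (\<lambda>_. 0))) (v, 0))) (at x)"
      by (rule has_derivative_compose[where f = "\<lambda>z. (z, trunc k (\<lambda>_. 0))"])
        (use C_infinity_has_derivative[OF C_infinity_Hs[OF f h]] in \<open>auto intro!: derivative_eq_intros\<close>)
    then have "(\<lambda>z. H f h k z (\<lambda>_. 0)) differentiable (at x)"
      unfolding H_eq_Hs[of f h k] differentiable_def by blast
    then have "bounded_linear ?D"
      by (simp add: frechet_derivative_works has_derivative_bounded_linear)
    then have "real_analytic (\<lambda>a. ?D (f x a))"
      by (rule real_analytic_linear_compose[OF analytic])
    moreover have "K x a = ?D (f x a)" for a
      unfolding K_def k using indep[of k] k by (intro H_Suc_of_input_independent) simp
    then have "K x = (\<lambda>a. ?D (f x a))" ..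
    ultimately show ?thesis by simp
  qed
  have K_deriv: "(K x has_real_derivative dH f h r x a) (at a)" for x a
  proof -
    let ?p = "\<lambda>a. (x, trunc r (\<lambda>_. a))"
    have "?p differentiable (at a)"
      unfolding trunc_def differentiable_def by (auto intro!: exI derivative_eq_intros)
    then have "(\<lambda>a. Hs f h r (?p a)) differentiable (at a)"
      using C_infinity_has_derivative[OF C_infinity_Hs[OF f h]]
      by (intro differentiable_compose[of "Hs f h r" ?p]) (auto simp: differentiable_def)
    then have "K x differentiable (at a)"
      unfolding K_def H_eq_Hs[of f h r] .
    then show ?thesis
      unfolding dH_def K_def[symmetric, abs_def] using DERIV_deriv_iff_real_differentiable by blast
  qed

  define S where "S = {x. \<forall>a. (x, a) \<in> C}"
  have "closed S"
    unfolding S_def using slice(2) by (simp add: Collect_all_eq closed_INT)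
  \<comment> \<open>A failure of the estimate persists on a ball of inputs. By \<open>base\<close>
    the slope vanishes there, so \<open>K x\<close> is constant on the ball and, by analyticity,
    everywhere.\<close>
  have S1: "x \<in> S" if "K x b \<noteq> K x c" for x b c
  proof (rule ccontr)
    assume "x \<notin> S"
    define V where "V = - {a. (x, a) \<in> C}"
    have "open V" "V \<noteq> {}"
      using slice(1)[of x] \<open>x \<notin> S\<close> by (auto simp: V_def S_def)
    then obtain a \<epsilon> where \<epsilon>: "0 < \<epsilon>" "ball a \<epsilon> \<subseteq> V"
      using open_contains_ball by blast
    have "(K x has_real_derivative 0) (at s within ball a \<epsilon>)" if "s \<in> ball a \<epsilon>" for s
    proof -
      have "dH f h r x s = 0"
        using base[of x s] \<epsilon>(2) that by (auto simp: V_def)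
      then show ?thesis
        using K_deriv[of x s] by (simp add: has_field_derivative_at_within)
    qed
    then obtain k' where "\<And>s. s \<in> ball a \<epsilon> \<Longrightarrow> K x s = k'"
      using has_field_derivative_zero_constant[of "ball a \<epsilon>" "K x"] convex_ball by blast
    then have "K x s = k'" for s
      using real_analytic_locally_constant[OF K_analytic K_cont2, of "ball a \<epsilon>" x k'] \<epsilon>(1) by simp
    then show False using that by metis
  qed
  \<comment> \<open>With \<open>K x\<close> constant, \<open>B (x, a)\<close> does not depend on
    \<open>a\<close>, yet it would bound |a| for every \<open>a\<close>.\<close>
  have S2: "\<exists>b c. K x b \<noteq> K x c" if "x \<in> S" for x
  proof (rule ccontr)
    assume "\<nexists>b c. K x b \<noteq> K x c"
    then have const: "K x a = K x 0" for a by blast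
    have "H f h j x (\<lambda>_. a) = H f h j x (\<lambda>_. 0)" if "j \<le> r" for a j
      using indep[of j x "\<lambda>_. a" "\<lambda>_. 0"] const[of a] that by (cases "j = r") (auto simp: K_def)
    then have B_const: "B (x, a) = B (x, 0)" for a
      unfolding B_def G_def by (auto intro!: arg_cong[where f = \<gamma>] L2_set_cong)
    have B_bound: "norm (a, x) \<le> B (x, 0)" for a :: real
    proof -
      have "(x, a) \<in> C" using \<open>x \<in> S\<close> unfolding S_def by blast
      then show ?thesis unfolding C_def B_const[of a, symmetric] by simp
    qed
    have "\<bar>a\<bar> \<le> B (x, 0)" for a :: real
      using norm_fst_le[of a x] B_bound[of a] by simp
    from this[of "\<bar>B (x, 0)\<bar> + 1"] show False by simp
  qed
  \<comment> \<open>Nonconstancy is a union of open conditions by continuity in x, whereas the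
    definition of \<open>S\<close> is an intersection of closed ones.\<close>
  have "S = (\<Union>b. \<Union>c. {x. K x b \<noteq> K x c})"
  proof (rule set_eqI)
    fix x
    have "x \<in> S \<longleftrightarrow> (\<exists>b c. K x b \<noteq> K x c)"
      by (rule iffI, erule S2, elim exE, erule S1)
    then show "x \<in> S \<longleftrightarrow> x \<in> (\<Union>b. \<Union>c. {x. K x b \<noteq> K x c})" by simp
  qed
  then have "open S"
    using K_cont1 by (auto intro!: open_UN open_Collect_neq)
  moreover have "x0 \<in> S"
    using dep by (intro S1[of x0 "u0 0" "v0 0"]) (simp add: cong)
  ultimately have "S = UNIV"
    using clopen[of S] \<open>closed S\<close> by blast
  then show ?thesis
    by (auto simp: S_def C_def B_def G_def)
qed

lemma output_input_stable_imp_relative_degree: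
  fixes f :: "real^'n \<Rightarrow> real \<Rightarrow> real^'n"
  assumes f: "C_infinity (\<lambda>(x, u). f x u)" and h: "C_infinity h"
    and ois: "output_input_stable f h N" and analytic: "\<And>x. real_analytic (f x)"
    and "f 0 0 = 0" "h 0 = 0"
  shows "\<exists>r\<le>N. has_relative_degree f h r"
proof -
  obtain \<alpha> \<gamma> where \<alpha>: "class_K \<alpha>" and \<gamma>: "class_K_inf \<gamma>"
    and bound: "\<And>x U. norm (U 0, x) \<le> \<alpha> (norm x) + \<gamma> (L2_set (\<lambda>j. H f h j x U) {..N})"
    using output_input_stable_initial_bound[OF f h ois] by metis
  note \<gamma>K = class_K_inf_D[OF \<gamma>]
  define P where "P k \<longleftrightarrow> (\<exists>x u v. H f h k x u \<noteq> H f h k x v)" for k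
  have "\<exists>k\<le>N. P k"
  proof (rule ccontr)
    assume "\<nexists>k. k \<le> N \<and> P k"
    then have eq: "H f h k 0 (\<lambda>_. a) = H f h k 0 (\<lambda>_. 0)" if "k \<le> N" for k a
      using that unfolding P_def by blast
    \<comment> \<open>If no H_k with k <= N saw the input, the right-hand side of the estimate at x
      = 0 would be this fixed number for all inputs.\<close>
    define b where "b = \<alpha> (norm (0::real^'n)) + \<gamma> (L2_set (\<lambda>j. H f h j 0 (\<lambda>_. 0)) {..N})"
    have "norm (a, 0::real^'n) \<le> b" for a :: real
    proof -
      have "L2_set (\<lambda>j. H f h j 0 (\<lambda>_. a)) {..N} = L2_set (\<lambda>j. H f h j 0 (\<lambda>_. 0)) {..N}"
        by (rule L2_set_cong) (auto intro: eq)
      then show ?thesis using bound[of "\<lambda>_. a" 0] by (simp add: b_def)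
    qed
    from this[of "\<bar>b\<bar> + 1"] show False by (simp add: norm_Pair)
  qed
  then obtain k where "P k" "k \<le> N" by blast
  define r where "r = (LEAST k. P k)"
  have "P r" "r \<le> N"
    using LeastI[of P, OF \<open>P k\<close>] Least_le[of P, OF \<open>P k\<close>] \<open>k \<le> N\<close> by (auto simp: r_def)
  have indep: "H f h k x u = H f h k x v" if "k < r" for k x u v
    using not_less_Least[of k P] that unfolding r_def P_def by blast
  have "\<not> P 0" by (simp add: P_def)
  then have "0 < r" using \<open>P r\<close> by (cases r) auto
  obtain x0 u0 v0 where dep: "H f h r x0 u0 \<noteq> H f h r x0 v0"
    using \<open>P r\<close> unfolding P_def by blast
  have bound_r: "norm (a, x) \<le> \<alpha> (norm x) + \<gamma> (L2_set (\<lambda>j. H f h j x (\<lambda>_. a)) {..r})" for x a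
    by (rule bound_at_relative_degree[OF f h analytic \<alpha> \<gamma> bound \<open>0 < r\<close> \<open>r \<le> N\<close> _ dep]) (rule indep)

  \<comment> \<open>Below r the functions H_j depend on x alone, so the zero input represents
    them.\<close>
  define g where "g x = (\<Sum>j<r. \<bar>H f h j x (\<lambda>_. 0)\<bar>)" for x
  have "continuous_on UNIV (\<lambda>x. H f h j x (\<lambda>_. 0))" for j
    using continuous_on_compose2[OF continuous_on_H_const[OF f h, of j], of UNIV "\<lambda>x. (x, 0)"]
    by (simp add: continuous_on_Pair)
  then have "continuous_on UNIV g"
    unfolding g_def by (intro continuous_intros)
  moreover have "g 0 = 0"
    using H_equilibrium[OF f h \<open>f 0 0 = 0\<close> \<open>h 0 = 0\<close>] by (simp add: g_def)
  ultimately obtain \<omega> where \<omega>: "class_K \<omega>" "\<And>s. 0 \<le> s \<Longrightarrow> s \<le> \<omega> s" "\<And>x. g x \<le> \<omega> (norm x)"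
    using class_K_majorant by blast

  \<comment> \<open>\<gamma> is split over \<omega>(|x|) + |H_r|. As \<alpha> is only of class K,
    \<rho>1 gets its unboundedness from \<gamma>, through \<open>s \<le> \<omega> s\<close>.\<close>
  define \<rho>1 where "\<rho>1 s = \<alpha> s + \<gamma> (2 * \<omega> s)" for s
  define \<rho>2 where "\<rho>2 s = \<gamma> (2 * s)" for s
  have \<rho>1K: "class_K \<rho>1"
    unfolding \<rho>1_def
    by (rule class_K_add[OF \<alpha> class_K_compose[OF \<gamma>K class_K_compose[OF class_K_scale \<omega>(1)]]]) simp
  have \<rho>1: "class_K_inf \<rho>1"
  proof (rule class_K_inf_dominate[OF \<gamma> \<rho>1K])
    fix s :: real assume "0 \<le> s"
    then show "\<gamma> s \<le> \<rho>1 s"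
      using class_K_nonneg[OF \<alpha>, of s] class_K_mono[OF \<gamma>K, of s "2 * \<omega> s"] \<omega>(2)[of s]
      by (simp add: \<rho>1_def)
  qed
  have \<rho>2: "class_K_inf \<rho>2"
    unfolding \<rho>2_def
    by (rule class_K_inf_dominate[OF \<gamma> class_K_compose[OF \<gamma>K class_K_scale]])
      (auto intro: class_K_mono[OF \<gamma>K])
  have "\<bar>u 0\<bar> \<le> \<rho>1 (norm x) + \<rho>2 \<bar>H f h r x u\<bar>" for x u
  proof -
    let ?L = "L2_set (\<lambda>j. H f h j x (\<lambda>_. u 0)) {..r}"
    have "?L \<le> (\<Sum>j\<le>r. \<bar>H f h j x (\<lambda>_. u 0)\<bar>)"
      by (rule L2_set_le_sum_abs)
    also have "\<dots> = (\<Sum>j<r. \<bar>H f h j x (\<lambda>_. u 0)\<bar>) + \<bar>H f h r x (\<lambda>_. u 0)\<bar>"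
      by (simp add: lessThan_Suc_atMost[symmetric])
    also have "(\<Sum>j<r. \<bar>H f h j x (\<lambda>_. u 0)\<bar>) = g x"
      unfolding g_def by (intro sum.cong refl arg_cong[where f = abs] indep) simp
    also have "H f h r x (\<lambda>_. u 0) = H f h r x u"
      by (rule H_relative_degree_cong[OF \<open>0 < r\<close>], erule indep, simp)
    finally have "?L \<le> \<omega> (norm x) + \<bar>H f h r x u\<bar>"
      using \<omega>(3)[of x] by simp
    then have "\<gamma> ?L \<le> \<gamma> (\<omega> (norm x) + \<bar>H f h r x u\<bar>)"
      by (intro class_K_mono[OF \<gamma>K]) auto
    also have "\<dots> \<le> \<gamma> (2 * \<omega> (norm x)) + \<gamma> (2 * \<bar>H f h r x u\<bar>)"
      by (intro class_K_add_le[OF \<gamma>K] class_K_nonneg[OF \<omega>(1)]) auto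
    finally show ?thesis
      using bound_r[of "u 0" x] norm_fst_le[of "u 0" x] by (simp add: \<rho>1_def \<rho>2_def)
  qed
  then have "has_relative_degree f h r"
    unfolding has_relative_degree_def using \<open>0 < r\<close> indep \<rho>1 \<rho>2 by blast
  with \<open>r \<le> N\<close> show ?thesis by blast
qed

theorem theorem1:
  fixes f :: "real^'n \<Rightarrow> real \<Rightarrow> real^'n" and h :: "real^'n \<Rightarrow> real"
  assumes "C_infinity (\<lambda>(x, u). f x u)" and "C_infinity h"
  shows
    "(\<forall>r k. has_relative_degree f h r \<and> weakly_uniformly_0_detectable f h k \<longrightarrow>
        output_input_stable f h (max r k)) \<and>
     (\<forall>N. output_input_stable f h N \<longrightarrow> weakly_uniformly_0_detectable f h N) \<and>
     (\<forall>N. output_input_stable f h N \<and> (\<forall>x. real_analytic (f x)) \<and> f 0 0 = 0 \<and> h 0 = 0 \<longrightarrow>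
        (\<exists>r\<le>N. has_relative_degree f h r))"
  using relative_degree_detectable_imp_output_input_stable[OF assms]
    output_input_stable_imp_detectable[of f h]
    output_input_stable_imp_relative_degree[OF assms]
  by blast

end
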